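(* Suppose $F$ is twice differentiable at $0$ and $F'(0)u>F(u)$ for $u\in(0,1]$. Then $\alpha_*=1/F'(0)$. Suppose moreover that $I=\{i>1:F^{(i)}(0)\ne 0\}\neq\varnothing$, and let $\ell=\min I$ and $\nu_0=\dfrac{2\ell-2}{2\ell-1}$. If $\alpha=\alpha_*$, then $$\lim_{n\to\infty}\frac{\log R_n}{\log n}=\nu_0\qquad\text{almost surely},$$ and the upper bound can be strengthened to $$\limsup_{n\to\infty}\frac{R_n}{n^{\nu_0}(\log n)^{1-\nu_0}}\le\left\{\frac{\ell!\,\sqrt{2(1+\nu_0)}\,F'(0)^\ell}{|F^{(\ell)}(0)|}\right\}^{2(1-\nu_0)}\qquad\text{almost surely.}$$ Furthermore, almost surely, $V_n/R_n\to\beta_*$ and the number of true discoveries satisfies $R_n-V_n\sim(1-\beta_* )R_n$ as $n\to\infty$.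
   Context: Random effects model: $\pi\in(0,1)$ is fixed; $(p_1,\theta_1),(p_2,\theta_2),\ldots$ is an infinite i.i.d. sequence, $\theta_j\in\{0,1\}$ with $\Pr\{\theta_j=1\}=\pi$ ($\theta_j=1$ means that the $j$th null is false), and for $u\in[0,1]$, $\Pr\{p_j\le u\mid\theta_j=0\}=u$ and $\Pr\{p_j\le u\mid\theta_j=1\}=G(u)$. The common distribution function of the $p$-values is $F(u)=(1-\pi)u+\pi G(u)$; it is assumed that $F$ is continuous on $[0,1]$ with $F(0)=0$. Derivatives at $0$ are one-sided, and the derivatives $F^{(i)}(0)$, $i\le\ell$, appearing in the statement are understood to exist. Put $\alpha_*=\inf_{0<u\le 1}u/F(u)$ and $\beta_*=(1-\pi)\alpha_*$. Benjamini–Hochberg (BH) procedure at target level $\alpha$ applied, for each $n$, to the first $n$ $p$-values $p_1,\ldots,p_n$: let $p_{n:1}\le\cdots\le p_{n:n}$ be the order statistics, $p_{n:0}=0$, and $R_n=\max\{j\in\{0,\dots,n\}:p_{n:j}\le\alpha j/n\}$. The nulls with $p$-values $\le p_{n:R_n}$ are rejected, so $R_n$ is the number of rejections. $V_n=\#\{j\le n:p_j\le p_{n:R_n},\ \theta_j=0\}$ is the number of false rejections. *)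

theory Defs
  imports "HOL-Probability.Probability" "HOL-Library.Landau_Symbols"
begin

text \<open>Higher derivatives of a real function relative to a set \<open>S\<close>. For \<open>S = {0..1}\<close>
  they are one-sided at 0 and two-sided at interior points.\<close>

fun higher_deriv_within :: "real set \<Rightarrow> (real \<Rightarrow> real) \<Rightarrow> nat \<Rightarrow> real \<Rightarrow> real" where
  "higher_deriv_within S f 0 x = f x"
| "higher_deriv_within S f (Suc k) x =
     vector_derivative (higher_deriv_within S f k) (at x within S)"

text \<open>The \<open>(k+1)\<close>-st derivative exists at \<open>a\<close> iff the \<open>k\<close>-th one exists at all points of
  \<open>S\<close> near \<open>a\<close> (including \<open>a\<close>) and is itself differentiable at \<open>a\<close> relative to \<open>S\<close>.\<close>

fun times_differentiable_within :: "real set \<Rightarrow> (real \<Rightarrow> real) \<Rightarrow> nat \<Rightarrow> real \<Rightarrow> bool" where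
  "times_differentiable_within S f 0 a \<longleftrightarrow> True"
| "times_differentiable_within S f (Suc k) a \<longleftrightarrow>
     (\<forall>\<^sub>F x in nhds a. x \<in> S \<longrightarrow> times_differentiable_within S f k x) \<and>
     higher_deriv_within S f k differentiable (at a within S)"

definition pval_cdf :: "real \<Rightarrow> (real \<Rightarrow> real) \<Rightarrow> real \<Rightarrow> real" where
  "pval_cdf \<pi> G u = (1 - \<pi>) * u + \<pi> * G u"

text \<open>Sequences are indexed from 0, so the first \<open>n\<close> hypotheses are those with index \<open>< n\<close>.
  \<open>\<theta> j \<omega>\<close> holds iff the \<open>j\<close>-th null hypothesis is false.\<close>

locale random_effects_model = prob_space M
  for M :: "'a measure" +
  fixes p :: "nat \<Rightarrow> 'a \<Rightarrow> real"
    and \<theta> :: "nat \<Rightarrow> 'a \<Rightarrow> bool"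
    and \<pi> :: real
    and G :: "real \<Rightarrow> real"
  assumes pi_range: "0 < \<pi>" "\<pi> < 1"
    and indep: "indep_vars (\<lambda>_. borel \<Otimes>\<^sub>M count_space UNIV) (\<lambda>j \<omega>. (p j \<omega>, \<theta> j \<omega>)) UNIV"
    and ident: "\<And>j. distr M (borel \<Otimes>\<^sub>M count_space UNIV) (\<lambda>\<omega>. (p j \<omega>, \<theta> j \<omega>)) =
                     distr M (borel \<Otimes>\<^sub>M count_space UNIV) (\<lambda>\<omega>. (p 0 \<omega>, \<theta> 0 \<omega>))"
    and p_range: "\<And>j. AE \<omega> in M. p j \<omega> \<in> {0..1}"
    and theta_prob: "\<And>j. \<P>(\<omega> in M. \<theta> j \<omega>) = \<pi>"
    and p_null: "\<And>j u. u \<in> {0..1} \<Longrightarrow> \<P>(\<omega> in M. p j \<omega> \<le> u \<bar> \<not> \<theta> j \<omega>) = u"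
    and p_alt: "\<And>j u. u \<in> {0..1} \<Longrightarrow> \<P>(\<omega> in M. p j \<omega> \<le> u \<bar> \<theta> j \<omega>) = G u"
    and cdf_cont: "continuous_on {0..1} (pval_cdf \<pi> G)"
    and cdf_0: "pval_cdf \<pi> G 0 = 0"

definition alpha_star :: "(real \<Rightarrow> real) \<Rightarrow> real" where
  "alpha_star F = (INF u\<in>{0<..1}. u / F u)"

text \<open>\<open>order_stat x n j\<close> is the \<open>j\<close>-th smallest of \<open>x 0, \<dots>, x (n - 1)\<close> for \<open>1 \<le> j \<le> n\<close>,
  with the convention that it is 0 for \<open>j = 0\<close>.\<close>

definition order_stat :: "(nat \<Rightarrow> real) \<Rightarrow> nat \<Rightarrow> nat \<Rightarrow> real" where
  "order_stat x n j = (if j = 0 then 0 else sort (map x [0..<n]) ! (j - 1))"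

definition BH_R :: "real \<Rightarrow> (nat \<Rightarrow> real) \<Rightarrow> nat \<Rightarrow> nat" where
  "BH_R \<alpha> x n = Max {j \<in> {0..n}. order_stat x n j \<le> \<alpha> * real j / real n}"

definition BH_V :: "real \<Rightarrow> (nat \<Rightarrow> real) \<Rightarrow> (nat \<Rightarrow> bool) \<Rightarrow> nat \<Rightarrow> nat" where
  "BH_V \<alpha> x t n = card {j. j < n \<and> x j \<le> order_stat x n (BH_R \<alpha> x n) \<and> \<not> t j}"

end

theory Submission
  imports Defs "HOL-Real_Asymp.Real_Asymp"
begin

text \<open>
  Write \<open>S\<^sub>n(u)\<close> for the number of \<open>p\<close>-values \<open>\<le> u\<close> among the first \<open>n\<close> and \<open>a = F'(0)\<close>, so that the
  critical target level is \<open>1/a\<close>. The BH procedure looks for points where the empirical process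
  reaches the tangent: \<open>S\<^sub>n(u) \<ge> n a u\<close> forces \<open>R\<^sub>n \<ge> S\<^sub>n(u)\<close>, and conversely \<open>S\<^sub>n(R\<^sub>n/(a n)) = R\<^sub>n\<close>.
  With \<open>c = |F\<^sup>(\<^sup>l\<^sup>)(0)| / l!\<close> the Taylor expansion of \<open>F\<close> at 0 is \<open>a u - c u\<^sup>l + o(u\<^sup>l)\<close>. So the mean
  \<open>n F(u)\<close> of \<open>S\<^sub>n(u)\<close> stays below the tangent by about \<open>n c u\<^sup>l\<close>, while \<open>S\<^sub>n(u)\<close> fluctuates by about
  \<open>sqrt (n a u)\<close>. Both are of the same size when \<open>n u\<^sup>2\<^sup>l\<^sup>-\<^sup>1\<close> is of order 1, which is \<open>n u\<close> of order
  \<open>n\<close> to the power \<open>(2l-2)/(2l-1)\<close>; this is where the exponent \<open>\<nu>\<close> comes from.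

  \<^emph>\<open>Upper bound\<close> (\<open>upper_bound_AE\<close>). A Chernoff bound (\<open>prob_ge_rank\<close>) makes the probability of
  \<open>S\<^sub>n(k/(a n)) \<ge> k\<close> at most \<open>exp (- c\<^sup>2 \<kappa>\<^sup>2\<^sup>l\<^sup>-\<^sup>1 / (2 a\<^sup>2\<^sup>l) \<cdot> ln n)\<close>, roughly, for \<open>k\<close> beyond \<open>\<kappa>\<close> times
  \<open>n\<^sup>\<nu> (ln n)\<^sup>1\<^sup>-\<^sup>\<nu>\<close>. About \<open>n\<^sup>\<nu>\<close> ranks \<open>k\<close> matter, and the Borel-Cantelli lemma costs one more factor
  \<open>n\<close>, so the constant in the exponent has to exceed \<open>1 + \<nu>\<close>. Solving for \<open>\<kappa>\<close> gives the constant in the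
  limsup.

  \<^emph>\<open>Lower bound\<close> (\<open>lower_bound_AE\<close>). For \<open>u\<close> slightly smaller, by a factor \<open>n\<^sup>-\<^sup>\<epsilon>\<close>, the shortfall
  \<open>n c u\<^sup>l\<close> is negligible against \<open>sqrt (n a u)\<close>, so at any single such \<open>u\<close> the process reaches the
  tangent with a probability bounded away from 0 (\<open>hits_anticoncentration\<close>). To make failure
  summable, use many scales \<open>u\<^sub>1 < \<dots> < u\<^sub>m\<close> whose ratio \<open>(ln n)\<^sup>2\<close> is so large that the count below
  \<open>u\<^sub>s\<^sub>-\<^sub>1\<close> hardly influences the fluctuation at scale \<open>u\<^sub>s\<close>. The counts in the disjoint intervals
  \<open>(u\<^sub>s\<^sub>-\<^sub>1, u\<^sub>s]\<close> are multinomial, hence negatively dependent (\<open>hits_negative_dependence\<close>), and all scales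
  fail with probability at most \<open>(79/80)\<^sup>m\<close>. Since \<open>m\<close> is only about \<open>sqrt (ln n)\<close>, this is summable
  not over \<open>n\<close> but over blocks of sample sizes: inside a block of relative length \<open>(ln n)\<^sup>-\<^sup>3\<close> the
  additional samples change the centred counts by less than the standard deviation (\<open>block_failure\<close>), and there are
  few enough blocks.

  \<^emph>\<open>False discoveries\<close> (\<open>V_ratio_AE\<close>). \<open>V\<^sub>n\<close> counts the true nulls with \<open>p\<close>-value at most \<open>R\<^sub>n/(a n)\<close>.
  Since \<open>R\<^sub>n \<ge> sqrt n\<close> eventually, a Chernoff bound uniform over all ranks \<open>k \<ge> sqrt n\<close> replaces this
  count by its mean \<open>(1-\<pi>) R\<^sub>n / a\<close>.
\<close>

section \<open>Independent letters from a finite alphabet\<close>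

definition words :: "'b set \<Rightarrow> nat \<Rightarrow> 'b list set" where
  "words A n = {ys. set ys \<subseteq> A \<and> length ys = n}"

text \<open>The expectation of \<open>h\<close> over words of \<open>n\<close> independent letters with weights \<open>q\<close>. As a finite sum it
  needs no integrability and satisfies a recursion in the first letter (\<open>word_sum_Suc\<close>), so that statements
  about multinomial and binomial counts become inductions on \<open>n\<close>.\<close>

definition word_sum :: "'b set \<Rightarrow> ('b \<Rightarrow> real) \<Rightarrow> nat \<Rightarrow> ('b list \<Rightarrow> real) \<Rightarrow> real" where
  "word_sum A q n h = (\<Sum>ys\<in>words A n. prod_list (map q ys) * h ys)"

lemma word_sum_0 [simp]: "word_sum A q 0 h = h []"
proof -
  have "words A 0 = {[]}" by (auto simp: words_def)
  thus ?thesis by (simp add: word_sum_def)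
qed

lemma word_sum_Suc:
  assumes "finite A"
  shows "word_sum A q (Suc n) h = (\<Sum>x\<in>A. q x * word_sum A q n (\<lambda>ys. h (x # ys)))"
proof -
  have W: "words A (Suc n) = (\<lambda>(x, ys). x # ys) ` (A \<times> words A n)"
    unfolding words_def by (auto simp: length_Suc_conv image_iff)
  have inj: "inj_on (\<lambda>(x, ys). x # ys) (A \<times> words A n)"
    by (auto simp: inj_on_def)
  show ?thesis
    unfolding word_sum_def W sum.reindex[OF inj]
    by (simp add: sum.cartesian_product sum_distrib_left split_def mult.assoc)
qed

lemma word_sum_mono:
  assumes "\<And>x. x \<in> A \<Longrightarrow> 0 \<le> q x" "\<And>ys. h ys \<le> h' ys"
  shows "word_sum A q n h \<le> word_sum A q n h'"
  unfolding word_sum_def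
proof (rule sum_mono)
  fix ys assume "ys \<in> words A n"
  hence "0 \<le> prod_list (map q ys)"
    using assms(1) by (intro prod_list_nonneg) (auto simp: words_def)
  thus "prod_list (map q ys) * h ys \<le> prod_list (map q ys) * h' ys"
    by (rule mult_left_mono[OF assms(2)])
qed

lemma word_sum_add:
  "word_sum A q n (\<lambda>ys. h ys + h' ys) = word_sum A q n h + word_sum A q n h'"
  by (simp add: word_sum_def algebra_simps sum.distrib)

lemma word_sum_cmult: "word_sum A q n (\<lambda>ys. c * h ys) = c * word_sum A q n h"
  by (simp add: word_sum_def sum_distrib_left mult_ac)

lemma word_sum_const:
  assumes "finite A" "(\<Sum>x\<in>A. q x) = 1"
  shows "word_sum A q n (\<lambda>_. c) = c"
  by (induction n) (simp_all add: word_sum_Suc assms flip: sum_distrib_right)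

section \<open>Negative dependence of multinomial counts\<close>

definition below_prob :: "'b set \<Rightarrow> ('b \<Rightarrow> real) \<Rightarrow> nat \<Rightarrow> 'b set \<Rightarrow> ('b \<Rightarrow> nat) \<Rightarrow> real" where
  "below_prob A q n I x = word_sum A q n (\<lambda>ys. of_bool (\<forall>i\<in>I. count_list ys i < x i))"

text \<open>Drawing the letter \<open>a\<close> first lowers the bound on the remaining occurrences of \<open>a\<close> by one. The truncated
  subtraction is harmless at \<open>x a = 0\<close>: the event is empty before and after.\<close>

lemma below_prob_Suc:
  assumes "finite A"
  shows "below_prob A q (Suc n) I x
           = (\<Sum>a\<in>A. q a * below_prob A q n I (if a \<in> I then x(a := x a - 1) else x))"
  unfolding below_prob_def word_sum_Suc[OF assms]
proof (intro sum.cong refl arg_cong2[where f = "(*)"] arg_cong[where f = "word_sum A q n"] ext)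
  fix a ys
  have "(\<forall>i\<in>I. count_list (a # ys) i < x i) \<longleftrightarrow>
    (\<forall>i\<in>I. count_list ys i < (if a \<in> I then x(a := x a - 1) else x) i)"
    by (cases "a \<in> I") (auto split: if_splits simp: less_diff_conv)
  thus "(of_bool (\<forall>i\<in>I. count_list (a # ys) i < x i) :: real) =
       of_bool (\<forall>i\<in>I. count_list ys i < (if a \<in> I then x(a := x a - 1) else x) i)"
    by simp
qed

lemma below_prob_mono:
  assumes "\<And>a. a \<in> A \<Longrightarrow> 0 \<le> q a" "\<And>i. x i \<le> y i"
  shows "below_prob A q n I x \<le> below_prob A q n I y"
  unfolding below_prob_def
  by (rule word_sum_mono) (use assms in \<open>auto intro: less_le_trans\<close>)

lemma below_prob_nonneg:
  assumes "\<And>a. a \<in> A \<Longrightarrow> 0 \<le> q a"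
  shows "0 \<le> below_prob A q n I x"
  unfolding below_prob_def word_sum_def
  by (intro sum_nonneg mult_nonneg_nonneg prod_list_nonneg)
     (use assms in \<open>auto simp: words_def\<close>)

lemma below_prob_cong: "(\<And>i. i \<in> I \<Longrightarrow> x i = y i) \<Longrightarrow> below_prob A q n I x = below_prob A q n I y"
  unfolding below_prob_def by (simp cong: ball_cong)

text \<open>Induction on \<open>n\<close>, conditioning on the first letter. If it is \<open>s\<close>, only the event for \<open>s\<close> gets less
  likely; if it is another letter, only the event for \<open>I\<close> does. Since no letter harms both, the two events are
  negatively correlated: with \<open>\<alpha>, \<alpha>'\<close> and \<open>\<beta>, Y\<close> as in the proof, the right-hand side exceeds the left-hand
  side by \<open>q\<^sub>s (\<alpha> - \<alpha>') ((1 - q\<^sub>s) \<beta> - Y) \<ge> 0\<close>.\<close>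

lemma below_prob_insert_le:
  assumes A: "finite A" and q: "\<And>a. a \<in> A \<Longrightarrow> 0 \<le> q a" "(\<Sum>a\<in>A. q a) = 1"
    and s: "s \<in> A" "s \<notin> I"
  shows "below_prob A q n (insert s I) x \<le> below_prob A q n {s} x * below_prob A q n I x"
proof (induction n arbitrary: x)
  case 0
  show ?case by (auto simp: below_prob_def)
next
  case (Suc n)
  let ?P = "below_prob A q n"
  define y where "y = x(s := x s - 1)"
  define z where "z = (\<lambda>a. if a \<in> I then x(a := x a - 1) else x)"
  define \<alpha> where "\<alpha> = ?P {s} x"
  define \<alpha>' where "\<alpha>' = ?P {s} y"
  define \<beta> where "\<beta> = ?P I x"
  define Y where "Y = (\<Sum>a\<in>A-{s}. q a * ?P I (z a))"
  have sum1: "(\<Sum>a\<in>A-{s}. q a) = 1 - q s"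
    using q(2) A s by (simp add: sum.remove)
  have le: "\<alpha>' \<le> \<alpha>" unfolding \<alpha>_def \<alpha>'_def y_def
    by (rule below_prob_mono) (use q in auto)
  have "Y \<le> (\<Sum>a\<in>A-{s}. q a * \<beta>)" unfolding Y_def \<beta>_def z_def
    by (intro sum_mono mult_left_mono below_prob_mono) (use q in auto)
  hence Y: "Y \<le> (1 - q s) * \<beta>" by (simp add: sum1 flip: sum_distrib_right)
  have yI: "?P I y = \<beta>" unfolding \<beta>_def y_def by (rule below_prob_cong) (use s in auto)
  have zs: "?P {s} (z a) = \<alpha>" if "a \<noteq> s" for a unfolding \<alpha>_def z_def
    by (rule below_prob_cong) (use s that in auto)
  have "below_prob A q (Suc n) (insert s I) x
      = q s * ?P (insert s I) y + (\<Sum>a\<in>A-{s}. q a * ?P (insert s I) (z a))"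
    unfolding below_prob_Suc[OF A] sum.remove[OF A s(1)] y_def z_def by simp
  also have "\<dots> \<le> q s * (?P {s} y * ?P I y) + (\<Sum>a\<in>A-{s}. q a * (?P {s} (z a) * ?P I (z a)))"
    by (intro add_mono sum_mono mult_left_mono Suc.IH) (use q s in auto)
  also have "\<dots> = q s * (\<alpha>' * \<beta>) + \<alpha> * Y"
    unfolding yI Y_def sum_distrib_left \<alpha>'_def[symmetric]
    by (intro arg_cong2[where f = "(+)"] sum.cong) (auto simp: zs)
  also have "\<dots> \<le> (q s * \<alpha>' + (1 - q s) * \<alpha>) * (q s * \<beta> + Y)"
  proof -
    have "0 \<le> q s * ((\<alpha> - \<alpha>') * ((1 - q s) * \<beta> - Y))"
      using le Y q s by (intro mult_nonneg_nonneg) auto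
    thus ?thesis by (simp add: algebra_simps)
  qed
  also have "q s * \<alpha>' + (1 - q s) * \<alpha> = below_prob A q (Suc n) {s} x"
  proof -
    have "below_prob A q (Suc n) {s} x = q s * \<alpha>' + (\<Sum>a\<in>A-{s}. q a * \<alpha>)"
      unfolding below_prob_Suc[OF A] sum.remove[OF A s(1)] \<alpha>'_def \<alpha>_def y_def
      by (intro arg_cong2[where f = "(+)"] sum.cong) auto
    thus ?thesis by (simp add: sum1 flip: sum_distrib_right)
  qed
  also have "q s * \<beta> + Y = below_prob A q (Suc n) I x"
    unfolding below_prob_Suc[OF A] sum.remove[OF A s(1)] \<beta>_def Y_def z_def using s by simp
  finally show ?case .
qed

lemma below_prob_le_prod:
  assumes A: "finite A" and q: "\<And>a. a \<in> A \<Longrightarrow> 0 \<le> q a" "(\<Sum>a\<in>A. q a) = 1"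
    and I: "I \<subseteq> A"
  shows "below_prob A q n I x \<le> (\<Prod>i\<in>I. below_prob A q n {i} x)"
proof -
  have "finite I" using I A finite_subset by blast
  thus ?thesis using I
  proof (induction I rule: finite_induct)
    case empty
    show ?case using word_sum_const[OF A q(2), of n 1] by (simp add: below_prob_def)
  next
    case (insert s I)
    have "below_prob A q n (insert s I) x \<le> below_prob A q n {s} x * below_prob A q n I x"
      using insert by (intro below_prob_insert_le A q) auto
    also have "\<dots> \<le> below_prob A q n {s} x * (\<Prod>i\<in>I. below_prob A q n {i} x)"
      using insert q by (intro mult_left_mono below_prob_nonneg) auto
    finally show ?case using insert by simp
  qed
qed

section \<open>Binomial counts: tails and anticoncentration\<close>

abbreviation bern :: "real \<Rightarrow> bool \<Rightarrow> real" where
  "bern q b \<equiv> (if b then q else 1 - q)"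

lemma word_sum_bern_Suc:
  "word_sum UNIV (bern q) (Suc n) h =
     q * word_sum UNIV (bern q) n (\<lambda>ys. h (True # ys)) + (1 - q) * word_sum UNIV (bern q) n (\<lambda>ys. h (False # ys))"
  by (simp add: word_sum_Suc UNIV_bool)

lemma word_sum_bern_const: "word_sum UNIV (bern q) n (\<lambda>_. c) = c"
  by (rule word_sum_const) (auto simp: UNIV_bool)

lemma word_sum_bern_exp:
  "word_sum UNIV (bern q) n (\<lambda>ys. exp (s * real (count_list ys True))) = (1 - q + q * exp s) ^ n"
  by (induction n)
     (simp_all add: word_sum_bern_Suc exp_add word_sum_cmult ring_distribs)

text \<open>The Chernoff bound with the optimal parameter \<open>s = ln (t / q)\<close>; the exponent is simplified with
  \<open>- ln (1 - y) \<ge> y + y\<^sup>2 / 2\<close> at \<open>y = (t - q) / t\<close>. Having \<open>2 t\<close>, not a larger constant, in the denominator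
  is what makes the constant in the limsup sharp enough.\<close>

lemma bern_upper_tail:
  assumes q: "0 < q" "q \<le> t" "q \<le> 1"
  shows "word_sum UNIV (bern q) n (\<lambda>ys. of_bool (real n * t \<le> real (count_list ys True)))
           \<le> exp (- (real n * (t - q)\<^sup>2 / (2 * t)))"
proof -
  define s where "s = ln (t / q)"
  have t: "t > 0" using q by auto
  have s: "s \<ge> 0" "exp s = t / q" unfolding s_def using q t by auto
  have "word_sum UNIV (bern q) n (\<lambda>ys. of_bool (real n * t \<le> real (count_list ys True)))
     \<le> word_sum UNIV (bern q) n (\<lambda>ys. exp (- s * (real n * t)) * exp (s * real (count_list ys True)))"
  proof (rule word_sum_mono)
    fix ys
    show "of_bool (real n * t \<le> real (count_list ys True))
       \<le> exp (- s * (real n * t)) * exp (s * real (count_list ys True))"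
      using s(1) by (auto simp: mult_left_mono simp flip: exp_add)
  qed (use q in auto)
  also have "\<dots> = exp (- s * (real n * t)) * (1 - q + q * exp s) ^ n"
    by (simp only: word_sum_cmult word_sum_bern_exp)
  also have "\<dots> \<le> exp (- s * (real n * t)) * exp (q * exp s - q) ^ n"
  proof -
    have "1 - q + q * exp s \<le> exp (q * exp s - q)"
      using exp_ge_add_one_self[of "q * exp s - q"] by linarith
    moreover have "0 \<le> 1 - q + q * exp s" using q by simp
    ultimately show ?thesis by (intro mult_left_mono power_mono) auto
  qed
  also have "\<dots> = exp (real n * (t - q - s * t))"
    using q by (simp add: s(2) field_simps flip: exp_of_nat_mult exp_add)
  also have "\<dots> \<le> exp (- (real n * (t - q)\<^sup>2 / (2 * t)))"
  proof -
    have "t - q + (t - q)\<^sup>2 / (2 * t) \<le> s * t"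
    proof -
      define y where "y = (t - q) / t"
      have y: "0 \<le> y" "y < 1" using q t by (auto simp: y_def)
      have "y + y\<^sup>2 / 2 \<le> - ln (1 - y)"
      proof -
        have "(\<lambda>y::real. - ln (1 - y) - (y + y\<^sup>2 / 2)) 0 \<le> (\<lambda>y. - ln (1 - y) - (y + y\<^sup>2 / 2)) y"
        proof (rule DERIV_nonneg_imp_nondecreasing[OF y(1)])
          fix x :: real assume x: "0 \<le> x" "x \<le> y"
          have "1 / (1 - x) - (1 + x) = x\<^sup>2 / (1 - x)"
            using x y by (simp add: field_simps power2_eq_square)
          hence "0 \<le> 1 / (1 - x) - (1 + x)" using x y by simp
          thus "\<exists>d. ((\<lambda>y. - ln (1 - y) - (y + y\<^sup>2 / 2)) has_real_derivative d) (at x) \<and> 0 \<le> d"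
            using x y
            by (intro exI[of _ "1 / (1 - x) - (1 + x)"] conjI)
               (auto intro!: derivative_eq_intros simp: field_simps power2_eq_square)
        qed
        thus ?thesis by simp
      qed
      also have "1 - y = q / t" using t by (simp add: y_def field_simps)
      also have "- ln (q / t) = s" unfolding s_def using q t by (simp add: ln_div)
      finally have "(y + y\<^sup>2 / 2) * t \<le> s * t" using t by simp
      also have "(y + y\<^sup>2 / 2) * t = t - q + (t - q)\<^sup>2 / (2 * t)"
        using t by (simp add: y_def field_simps power2_eq_square)
      finally show ?thesis .
    qed
    hence "t - q - s * t \<le> - ((t - q)\<^sup>2 / (2 * t))" by linarith
    hence "real n * (t - q - s * t) \<le> real n * - ((t - q)\<^sup>2 / (2 * t))"
      by (intro mult_left_mono) auto
    thus ?thesis by simp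
  qed
  finally show ?thesis .
qed

text \<open>The bound \<open>B\<close> may exceed the mean, so that one bound serves all sample sizes inside a block.\<close>

lemma bern_lower_tail:
  assumes q: "0 \<le> q" "q \<le> 1" and B: "real n * q \<le> B" "0 < B" and x: "0 \<le> x"
  shows "word_sum UNIV (bern q) n (\<lambda>ys. of_bool (real (count_list ys True) \<le> real n * q - x))
           \<le> exp (- (x\<^sup>2 / (2 * B)))"
proof -
  define s where "s = x / B"
  have s: "s \<ge> 0" unfolding s_def using x B by auto
  have "word_sum UNIV (bern q) n (\<lambda>ys. of_bool (real (count_list ys True) \<le> real n * q - x))
     \<le> word_sum UNIV (bern q) n (\<lambda>ys. exp (s * (real n * q - x)) * exp (- s * real (count_list ys True)))"
  proof (rule word_sum_mono)
    fix ys
    show "of_bool (real (count_list ys True) \<le> real n * q - x)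
       \<le> exp (s * (real n * q - x)) * exp (- s * real (count_list ys True))"
      using s(1) by (auto simp: mult_left_mono simp flip: exp_add)
  qed (use q in auto)
  also have "\<dots> = exp (s * (real n * q - x)) * (1 - q + q * exp (- s)) ^ n"
    by (simp only: word_sum_cmult word_sum_bern_exp)
  also have "\<dots> \<le> exp (s * (real n * q - x)) * exp (q * exp (- s) - q) ^ n"
  proof -
    have "1 - q + q * exp (- s) \<le> exp (q * exp (- s) - q)"
      using exp_ge_add_one_self[of "q * exp (- s) - q"] by linarith
    moreover have "0 \<le> 1 - q + q * exp (- s)" using q by simp
    ultimately show ?thesis by (intro mult_left_mono power_mono) auto
  qed
  also have "\<dots> = exp (real n * q * (exp (- s) - 1 + s) - s * x)"
    by (simp add: algebra_simps flip: exp_of_nat_mult exp_add)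
  also have "\<dots> \<le> exp (- (x\<^sup>2 / (2 * B)))"
  proof -
    have e: "exp (- s) - 1 + s \<le> s\<^sup>2 / 2"
    proof -
      have "0 \<le> s\<^sup>2 / 2 - (exp (- s) - 1 + s)"
      proof -
        have "(\<lambda>s::real. s\<^sup>2 / 2 - (exp (- s) - 1 + s)) 0 \<le> (\<lambda>s. s\<^sup>2 / 2 - (exp (- s) - 1 + s)) s"
        proof (rule DERIV_nonneg_imp_nondecreasing[OF s])
          fix y :: real assume y: "0 \<le> y" "y \<le> s"
          have "0 \<le> y + exp (- y) - 1" using exp_ge_add_one_self[of "- y"] by simp
          thus "\<exists>d. ((\<lambda>s. s\<^sup>2 / 2 - (exp (- s) - 1 + s)) has_real_derivative d) (at y) \<and> 0 \<le> d"
            by (intro exI[of _ "y + exp (- y) - 1"] conjI)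
               (auto intro!: derivative_eq_intros simp: field_simps)
        qed
        thus ?thesis by simp
      qed
      thus ?thesis by simp
    qed
    have "real n * q * (exp (- s) - 1 + s) \<le> B * (s\<^sup>2 / 2)"
      using B q e exp_ge_add_one_self[of "- s"] by (intro mult_mono) auto
    also have "B * (s\<^sup>2 / 2) - s * x = - (x\<^sup>2 / (2 * B))"
      using B by (simp add: s_def field_simps power2_eq_square)
    finally show ?thesis by simp
  qed
  finally show ?thesis .
qed

text \<open>The first four centred moments are proved together, as the expectation of an arbitrary quartic in the
  centred count, because the recursion maps quartics to quartics.\<close>

lemma bern_centred_moments:
  fixes q :: real
  defines "v \<equiv> q * (1 - q)"
  shows "word_sum UNIV (bern q) n (\<lambda>ys. a + b * (real (count_list ys True) - real n * q)
            + c * (real (count_list ys True) - real n * q) ^ 2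
            + d * (real (count_list ys True) - real n * q) ^ 3
            + e * (real (count_list ys True) - real n * q) ^ 4)
     = a + c * (n * v) + d * (n * v * (1 - 2 * q)) + e * (3 * (n * v)\<^sup>2 + n * v * (1 - 6 * v))"
proof (induction n arbitrary: a b c d e)
  case 0
  show ?case by simp
next
  case (Suc n)
  let ?W = "word_sum UNIV (bern q)"
  define g where "g = (\<lambda>(a::real) b c d e X. a + b * X + c * X ^ 2 + d * X ^ 3 + e * X ^ 4)"
  have shift: "g a b c d e (X + y) =
     g (g a b c d e y) (b + 2 * c * y + 3 * d * y^2 + 4 * e * y^3) (c + 3 * d * y + 6 * e * y^2)
       (d + 4 * e * y) e X" for a b c d e X y
    unfolding g_def by (simp add: power2_eq_square power3_eq_cube power4_eq_xxxx algebra_simps)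
  have IH: "?W n (\<lambda>ys. g a b c d e (real (count_list ys True) - real n * q)) =
     a + c * (n * v) + d * (n * v * (1 - 2 * q)) + e * (3 * (n * v)\<^sup>2 + n * v * (1 - 6 * v))"
    for a b c d e using Suc.IH unfolding g_def .
  have T: "?W n (\<lambda>ys. g a b c d e (real (count_list (True # ys) True) - real (Suc n) * q)) =
     ?W n (\<lambda>ys. g a b c d e ((real (count_list ys True) - real n * q) + (1 - q)))"
    by (simp add: algebra_simps)
  have F: "?W n (\<lambda>ys. g a b c d e (real (count_list (False # ys) True) - real (Suc n) * q)) =
     ?W n (\<lambda>ys. g a b c d e ((real (count_list ys True) - real n * q) + (- q)))"
    by (simp add: algebra_simps)
  have "?W (Suc n) (\<lambda>ys. g a b c d e (real (count_list ys True) - real (Suc n) * q))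
    = a + c * (Suc n * v) + d * (Suc n * v * (1 - 2 * q)) + e * (3 * (Suc n * v)\<^sup>2 + Suc n * v * (1 - 6 * v))"
    unfolding word_sum_bern_Suc T F shift IH
    unfolding g_def v_def by (simp add: algebra_simps power2_eq_square power3_eq_cube power4_eq_xxxx)
  thus ?case unfolding g_def .
qed

text \<open>The polynomial \<open>h\<close> in the proof is at most 0 up to \<open>1/10\<close> and never exceeds 10, but its expectation at the
  standardised count is at least \<open>1/8\<close>: the linear term has mean 0, the quadratic one contributes \<open>3/8\<close> and the
  quartic one costs at most \<open>1/8\<close>, because the fourth moment is at most \<open>16\<close> times the squared variance. So
  the count exceeds its mean by a tenth of the standard deviation with probability at least \<open>1/80\<close>.\<close>

lemma bern_anticoncentration:
  assumes q: "0 < q" "q \<le> 1 / 2" and nq: "1 \<le> real n * q"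
  shows "word_sum UNIV (bern q) n
           (\<lambda>ys. of_bool (real (count_list ys True) < real n * q + sqrt (real n * q) / 20)) \<le> 79 / 80"
proof -
  let ?W = "word_sum UNIV (bern q) n"
  define v where "v = q * (1 - q)"
  define V where "V = real n * v"
  define r where "r = sqrt V"
  have vq: "q / 2 \<le> v" unfolding v_def using q by (simp add: mult_left_mono field_simps)
  have V: "real n * q / 2 \<le> V" unfolding V_def using mult_left_mono[OF vq, of "real n"] by simp
  have V0: "V \<ge> 1 / 2" using V nq by simp
  have r: "r > 0" "r ^ 2 = V" "r ^ 4 = V ^ 2" using V0
    by (auto simp: r_def power4_eq_xxxx power2_eq_square)
  define h where "h = (\<lambda>z::real. z + 3 / 8 * z ^ 2 - z ^ 4 / 128 - 1 / 8)"
  have h10: "h z \<le> 10" for z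
  proof -
    have "0 \<le> (z\<^sup>2 - 32)\<^sup>2 + 16 * (z - 4)\<^sup>2 + 16" by simp
    thus ?thesis unfolding h_def by (simp add: power4_eq_xxxx power2_eq_square algebra_simps)
  qed
  have hneg: "h z \<le> 0" if z: "z \<le> 1 / 10" for z
  proof (cases "z \<ge> 0")
    case True
    have "z ^ 2 \<le> (1 / 10) ^ 2" using True z by (intro power_mono) auto
    hence "z ^ 2 \<le> 1 / 100" by (simp add: power2_eq_square)
    moreover have "0 \<le> z ^ 4" using True by simp
    ultimately show ?thesis using z unfolding h_def by linarith
  next
    case False
    define y where "y = - z"
    have y: "y > 0" using False by (simp add: y_def)
    have "0 \<le> y * (y - 4)\<^sup>2 * (y + 8)" using y by simp
    also have "\<dots> = y ^ 4 - 48 * y ^ 2 + 128 * y"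
      by (simp add: power4_eq_xxxx power2_eq_square algebra_simps)
    finally have "0 \<le> z ^ 4 - 48 * z ^ 2 - 128 * z" by (simp add: y_def)
    thus ?thesis unfolding h_def by simp
  qed
  define X where "X = (\<lambda>ys. real (count_list ys True) - real n * q)"
  have "1 / 8 \<le> - 1 / 8 + 3 / 8 - (3 * V\<^sup>2 + V * (1 - 6 * v)) / (128 * V\<^sup>2)"
  proof -
    have "V * (1 - 6 * v) \<le> V * 1" using V0 vq q by (intro mult_left_mono) auto
    also have "\<dots> \<le> 2 * V\<^sup>2" using V0 by (simp add: power2_eq_square)
    finally have "V * (1 - 6 * v) \<le> 2 * V\<^sup>2" .
    hence "3 * V\<^sup>2 + V * (1 - 6 * v) \<le> 16 * V\<^sup>2"
      using zero_le_power2[of V] by linarith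
    thus ?thesis using V0 by (simp add: field_simps)
  qed
  also have "\<dots> = ?W (\<lambda>ys. h (X ys / r))"
  proof -
    have "h (X ys / r) = - 1 / 8 + (1 / r) * X ys + (3 / (8 * V)) * X ys ^ 2 + 0 * X ys ^ 3
        + (- 1 / (128 * V\<^sup>2)) * X ys ^ 4" for ys
      unfolding h_def by (simp add: power_divide r)
    hence "?W (\<lambda>ys. h (X ys / r)) = - 1 / 8 + (3 / (8 * V)) * (n * v) + 0
         + (- 1 / (128 * V\<^sup>2)) * (3 * (n * v)\<^sup>2 + n * v * (1 - 6 * v))"
      unfolding X_def using bern_centred_moments[of q n "- 1 / 8" "1 / r" "3 / (8 * V)" 0 "- 1 / (128 * V\<^sup>2)"]
      by (simp add: v_def)
    thus ?thesis using V0 unfolding V_def[symmetric] by (simp add: field_simps)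
  qed
  also have "\<dots> \<le> ?W (\<lambda>ys. 10 + - 10 * of_bool (real (count_list ys True) < real n * q + sqrt (real n * q) / 20))"
  proof (rule word_sum_mono)
    fix ys
    have "sqrt (real n * q) / 20 \<le> r / 10"
    proof -
      have "sqrt (real n * q) \<le> sqrt (4 * V)" using V nq by (intro real_sqrt_le_mono) linarith
      also have "\<dots> = 2 * r" by (simp add: r_def real_sqrt_mult)
      finally show ?thesis by simp
    qed
    thus "h (X ys / r) \<le> 10 + - 10 * of_bool (real (count_list ys True) < real n * q + sqrt (real n * q) / 20)"
      using h10[of "X ys / r"] hneg[of "X ys / r"] r(1) by (auto simp: X_def field_simps)
  qed (use q in auto)
  also have "\<dots> = 10 - 10 * ?W (\<lambda>ys. of_bool (real (count_list ys True) < real n * q + sqrt (real n * q) / 20))"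
    by (simp only: word_sum_add word_sum_cmult word_sum_bern_const)
  finally show ?thesis by simp
qed

section \<open>Hitting counts of an i.i.d. sequence\<close>

locale iid_sequence = prob_space M
  for M :: "'a measure" +
  fixes X :: "nat \<Rightarrow> 'a \<Rightarrow> 'x" and N :: "'x measure"
  assumes indep_X: "indep_vars (\<lambda>_. N) X UNIV"
    and ident_X: "\<And>j. distr M N (X j) = distr M N (X 0)"
begin

lemma X_measurable [measurable]: "X j \<in> measurable M N"
  using indep_X by (auto simp: indep_vars_def)

lemma prob_X_eq:
  assumes E: "E \<in> sets N"
  shows "prob {\<omega>\<in>space M. X j \<omega> \<in> E} = prob {\<omega>\<in>space M. X 0 \<omega> \<in> E}"
proof -
  have *: "measure (distr M N (X i)) E = prob {\<omega>\<in>space M. X i \<omega> \<in> E}" for i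
    using E by (subst measure_distr) (auto intro!: arg_cong[where f = prob])
  show ?thesis using *[of j] *[of 0] ident_X[of j] by simp
qed

text \<open>Labelling the observations by finitely many letters turns \<open>n\<close> consecutive observations into a random word,
  whose law does not depend on the offset \<open>m\<close>.\<close>

lemma prob_word:
  fixes L :: "'x \<Rightarrow> 'b"
  assumes L: "L \<in> measurable N (count_space UNIV)"
    and A: "finite A" "\<And>x. x \<in> space N \<Longrightarrow> L x \<in> A"
  defines "q \<equiv> \<lambda>a. prob {\<omega>\<in>space M. L (X 0 \<omega>) = a}"
  shows "prob {\<omega>\<in>space M. Q (map (\<lambda>j. L (X j \<omega>)) [m..<m+n])}
           = word_sum A q n (\<lambda>ys. of_bool (Q ys))"
proof -
  note [measurable] = L
  define W where "W = (\<lambda>\<omega>. map (\<lambda>j. L (X j \<omega>)) [m..<m+n])"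
  have fin: "finite (words A n)" unfolding words_def using finite_lists_length_eq[OF A(1)] .
  have XN: "X j \<omega> \<in> space N" if "\<omega> \<in> space M" for j \<omega>
    using measurable_space[OF X_measurable that] .
  have W: "W \<omega> \<in> words A n" if "\<omega> \<in> space M" for \<omega>
    using XN[OF that] A(2) by (auto simp: W_def words_def)
  have single_eq: "{\<omega>\<in>space M. W \<omega> = ys} = space M \<inter> (\<Inter>j\<in>{m..<m+n}. X j -` (L -` {ys ! (j - m)} \<inter> space N) \<inter> space M)"
    if "length ys = n" for ys
  proof -
    have "W \<omega> = ys \<longleftrightarrow> (\<forall>j\<in>{m..<m+n}. L (X j \<omega>) = ys ! (j - m))" for \<omega>
    proof -
      have "W \<omega> = ys \<longleftrightarrow> (\<forall>i<n. L (X (m + i) \<omega>) = ys ! i)"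
        using that by (simp add: W_def list_eq_iff_nth_eq)
      also have "\<dots> \<longleftrightarrow> (\<forall>j\<in>{m..<m+n}. L (X j \<omega>) = ys ! (j - m))"
        by (auto dest!: le_Suc_ex)
      finally show ?thesis .
    qed
    thus ?thesis using XN by auto
  qed
  have single: "{\<omega>\<in>space M. W \<omega> = ys} \<in> events \<and> prob {\<omega>\<in>space M. W \<omega> = ys} = prod_list (map q ys)"
    if ys: "ys \<in> words A n" for ys
  proof (cases "n = 0")
    case True
    thus ?thesis using ys by (auto simp: W_def words_def prob_space)
  next
    case False
    have len: "length ys = n" using ys by (simp add: words_def)
    have meas: "L -` {a} \<inter> space N \<in> sets N" for a by measurable
    have eq: "{\<omega>\<in>space M. W \<omega> = ys} = (\<Inter>j\<in>{m..<m+n}. X j -` (L -` {ys ! (j - m)} \<inter> space N) \<inter> space M)"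
      unfolding single_eq[OF len] using False by auto
    have "prob {\<omega>\<in>space M. W \<omega> = ys} = (\<Prod>j\<in>{m..<m+n}. prob (X j -` (L -` {ys ! (j - m)} \<inter> space N) \<inter> space M))"
      unfolding eq by (rule indep_varsD[OF indep_X]) (use False meas in auto)
    also have "\<dots> = (\<Prod>j\<in>{m..<m+n}. q (ys ! (j - m)))"
    proof (rule prod.cong[OF refl])
      fix j
      have "prob (X j -` (L -` {ys ! (j - m)} \<inter> space N) \<inter> space M)
        = prob {\<omega>\<in>space M. X j \<omega> \<in> L -` {ys ! (j - m)} \<inter> space N}"
        by (rule arg_cong[where f = prob]) auto
      also have "\<dots> = prob {\<omega>\<in>space M. X 0 \<omega> \<in> L -` {ys ! (j - m)} \<inter> space N}"
        by (rule prob_X_eq[OF meas])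
      also have "\<dots> = q (ys ! (j - m))" unfolding q_def
        using XN by (intro arg_cong[where f = prob]) auto
      finally show "prob (X j -` (L -` {ys ! (j - m)} \<inter> space N) \<inter> space M) = q (ys ! (j - m))" .
    qed
    also have "\<dots> = (\<Prod>i<n. q (ys ! i))"
      by (rule prod.reindex_bij_witness[of _ "\<lambda>i. i + m" "\<lambda>j. j - m"]) auto
    also have "\<dots> = prod_list (map q ys)"
      by (simp add: prod.list_conv_set_nth len atLeast0LessThan)
    finally have pr: "prob {\<omega>\<in>space M. W \<omega> = ys} = prod_list (map q ys)" .
    have "{\<omega>\<in>space M. W \<omega> = ys} \<in> events"
      unfolding eq using False measurable_sets[OF X_measurable meas] by (intro sets.finite_INT) auto
    thus ?thesis using pr by blast
  qed
  have "prob {\<omega>\<in>space M. Q (W \<omega>)} = prob (\<Union>ys\<in>{ys\<in>words A n. Q ys}. {\<omega>\<in>space M. W \<omega> = ys})"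
    using W by (intro arg_cong[where f = prob]) auto
  also have "\<dots> = (\<Sum>ys\<in>{ys\<in>words A n. Q ys}. prob {\<omega>\<in>space M. W \<omega> = ys})"
    by (rule finite_measure_finite_Union) (use fin single in \<open>auto simp: disjoint_family_on_def\<close>)
  also have "\<dots> = (\<Sum>ys\<in>{ys\<in>words A n. Q ys}. prod_list (map q ys))"
    by (rule sum.cong) (use single in auto)
  also have "\<dots> = word_sum A q n (\<lambda>ys. of_bool (Q ys))"
    unfolding word_sum_def using fin by (simp add: sum.If_cases of_bool_def if_distrib Int_def cong: if_cong)
  finally show ?thesis unfolding W_def .
qed

definition hits :: "'x set \<Rightarrow> nat \<Rightarrow> nat \<Rightarrow> 'a \<Rightarrow> nat" where
  "hits E m n \<omega> = card {j\<in>{m..<n}. X j \<omega> \<in> E}"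

lemma hits_measurable [measurable]:
  assumes "E \<in> sets N"
  shows "hits E m n \<in> measurable M (count_space UNIV)"
proof -
  have "hits E m n = (\<lambda>\<omega>. \<Sum>j\<in>{m..<n}. if X j \<omega> \<in> E then 1 else 0)"
    by (auto simp: hits_def sum.If_cases Int_def fun_eq_iff)
  thus ?thesis using assms by simp
qed

lemma hits_eq_count_list:
  "hits E m (m + n) \<omega> = count_list (map (\<lambda>j. X j \<omega> \<in> E) [m..<m+n]) True"
proof -
  have "count_list (map f [m..<m+n]) True = card {j\<in>{m..<m+n}. f j}" for f :: "nat \<Rightarrow> bool"
  proof (induction n)
    case (Suc n)
    have "{j\<in>{m..<m + Suc n}. f j} = (if f (m + n) then insert (m + n) {j\<in>{m..<m+n}. f j} else {j\<in>{m..<m+n}. f j})"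
      by (auto simp: less_Suc_eq)
    thus ?case using Suc by simp
  qed simp
  thus ?thesis by (simp add: hits_def)
qed

lemma prob_hits:
  assumes E: "E \<in> sets N" and q: "q = prob {\<omega>\<in>space M. X 0 \<omega> \<in> E}"
  shows "prob {\<omega>\<in>space M. Q (hits E m (m + n) \<omega>)}
           = word_sum UNIV (bern q) n (\<lambda>ys. of_bool (Q (count_list ys True)))"
proof -
  have L: "(\<lambda>x. x \<in> E) \<in> measurable N (count_space UNIV)" using E by measurable
  have "prob {\<omega>\<in>space M. \<not> X 0 \<omega> \<in> E} = 1 - q"
    unfolding q using E by (subst prob_compl[symmetric]) (auto intro!: arg_cong[where f = prob])
  hence "(\<lambda>a. prob {\<omega>\<in>space M. (X 0 \<omega> \<in> E) = a}) = bern q"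
    by (auto simp: fun_eq_iff q)
  thus ?thesis
    using prob_word[OF L, of UNIV "\<lambda>ys. Q (count_list ys True)" m n]
    by (simp add: hits_eq_count_list)
qed

lemma hits_upper_tail:
  assumes E: "E \<in> sets N" and q: "q = prob {\<omega>\<in>space M. X 0 \<omega> \<in> E}" "0 < q" "q \<le> t"
  shows "prob {\<omega>\<in>space M. real n * t \<le> real (hits E m (m + n) \<omega>)} \<le> exp (- (real n * (t - q)\<^sup>2 / (2 * t)))"
  unfolding prob_hits[OF E q(1), where Q = "\<lambda>k. real n * t \<le> real k"]
  by (rule bern_upper_tail) (use q in auto)

lemma hits_lower_tail:
  assumes E: "E \<in> sets N" and q: "q = prob {\<omega>\<in>space M. X 0 \<omega> \<in> E}"
    and B: "real n * q \<le> B" "0 < B" and x: "0 \<le> x"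
  shows "prob {\<omega>\<in>space M. real (hits E m (m + n) \<omega>) \<le> real n * q - x} \<le> exp (- (x\<^sup>2 / (2 * B)))"
  unfolding prob_hits[OF E q, where Q = "\<lambda>k. real k \<le> real n * q - x"]
  by (rule bern_lower_tail) (use q B x in auto)

lemma hits_anticoncentration:
  assumes E: "E \<in> sets N" and q: "q = prob {\<omega>\<in>space M. X 0 \<omega> \<in> E}" "q \<le> 1 / 2" and nq: "1 \<le> real n * q"
  shows "prob {\<omega>\<in>space M. real (hits E m (m + n) \<omega>) < real n * q + sqrt (real n * q) / 20} \<le> 79 / 80"
  unfolding prob_hits[OF E q(1), where Q = "\<lambda>k. real k < real n * q + sqrt (real n * q) / 20"]
proof (rule bern_anticoncentration)
  have "q \<noteq> 0" using nq by auto
  thus "0 < q" unfolding q(1) by (simp add: zero_less_measure_iff)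
qed (use q nq in auto)

text \<open>Label each observation by the index of the set \<open>E s\<close> containing it, and by 0 if there is none.\<close>

lemma hits_negative_dependence:
  fixes E :: "nat \<Rightarrow> 'x set" and x :: "nat \<Rightarrow> real"
  assumes E: "\<And>s. s \<in> {1..k} \<Longrightarrow> E s \<in> sets N" and disj: "disjoint_family_on E {1..k}"
  shows "prob {\<omega>\<in>space M. \<forall>s\<in>{1..k}. real (hits (E s) m (m + n) \<omega>) < x s}
           \<le> (\<Prod>s\<in>{1..k}. prob {\<omega>\<in>space M. real (hits (E s) m (m + n) \<omega>) < x s})"
proof -
  define L where "L = (\<lambda>z. \<Sum>s\<in>{1..k}. if z \<in> E s then s else 0)"
  have L: "L \<in> measurable N (count_space UNIV)" unfolding L_def
    by (intro measurable_sum_nat measurable_If) (use E in \<open>auto simp: pred_def\<close>)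
  have L1: "L z = s" if "s \<in> {1..k}" "z \<in> E s" for z s
  proof -
    have "L z = (\<Sum>s'\<in>{1..k}. if s' = s then s else 0)" unfolding L_def
      by (rule sum.cong[OF refl]) (use that disjoint_family_onD[OF disj] in auto)
    thus ?thesis using that by simp
  qed
  have L0: "L z = 0" if "\<And>s. s \<in> {1..k} \<Longrightarrow> z \<notin> E s" for z
    unfolding L_def using that by (intro sum.neutral) auto
  have Lk: "L z \<in> {0..k}" for z
    using L0[of z] L1[of _ z] by (cases "\<exists>s\<in>{1..k}. z \<in> E s") auto
  have Liff: "L z = s \<longleftrightarrow> z \<in> E s" if "s \<in> {1..k}" for z s
  proof
    assume "L z = s"
    hence "L z \<noteq> 0" using that by auto
    then obtain s' where "s' \<in> {1..k}" "z \<in> E s'" using L0 by metis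
    thus "z \<in> E s" using L1[of s' z] \<open>L z = s\<close> by simp
  qed (rule L1[OF that])
  define q where "q = (\<lambda>a. prob {\<omega>\<in>space M. L (X 0 \<omega>) = a})"
  define y where "y = (\<lambda>s. nat \<lceil>x s\<rceil>)"
  have cnt: "hits (E s) m (m + n) \<omega> = count_list (map (\<lambda>j. L (X j \<omega>)) [m..<m+n]) s" if "s \<in> {1..k}" for s \<omega>
  proof -
    have "count_list (map f js) s = count_list (map (\<lambda>j. f j = s) js) True" for f :: "nat \<Rightarrow> nat" and js
      by (induction js) auto
    thus ?thesis unfolding hits_eq_count_list using Liff[OF that] by simp
  qed
  have xy: "real c < x s \<longleftrightarrow> c < y s" for c s
    unfolding y_def by (simp add: zless_nat_eq_int_zless less_ceiling_iff)
  have pr: "prob {\<omega>\<in>space M. \<forall>s\<in>J. real (hits (E s) m (m + n) \<omega>) < x s} = below_prob {0..k} q n J y"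
    if "J \<subseteq> {1..k}" for J
  proof -
    have "{\<omega>\<in>space M. \<forall>s\<in>J. real (hits (E s) m (m + n) \<omega>) < x s} =
      {\<omega>\<in>space M. \<forall>s\<in>J. count_list (map (\<lambda>j. L (X j \<omega>)) [m..<m+n]) s < y s}"
    proof (intro Collect_cong conj_cong ball_cong refl)
      fix \<omega> s assume "s \<in> J"
      hence "s \<in> {1..k}" using that by blast
      from xy cnt[OF this] show "real (hits (E s) m (m + n) \<omega>) < x s \<longleftrightarrow>
        count_list (map (\<lambda>j. L (X j \<omega>)) [m..<m+n]) s < y s" by simp
    qed
    thus ?thesis unfolding below_prob_def q_def
      using prob_word[OF L, of "{0..k}" "\<lambda>ys. \<forall>s\<in>J. count_list ys s < y s" m n] Lk by simp
  qed
  have sum1: "(\<Sum>a\<in>{0..k}. q a) = 1"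
  proof -
    have meas: "{\<omega>\<in>space M. L (X 0 \<omega>) = a} \<in> events" for a using L by measurable
    have "(\<Sum>a\<in>{0..k}. q a) = prob (\<Union>a\<in>{0..k}. {\<omega>\<in>space M. L (X 0 \<omega>) = a})" unfolding q_def
      by (rule finite_measure_finite_Union[symmetric]) (use meas in \<open>auto simp: disjoint_family_on_def\<close>)
    also have "(\<Union>a\<in>{0..k}. {\<omega>\<in>space M. L (X 0 \<omega>) = a}) = space M" using Lk by auto
    finally show ?thesis by (simp add: prob_space)
  qed
  have "below_prob {0..k} q n {1..k} y \<le> (\<Prod>s\<in>{1..k}. below_prob {0..k} q n {s} y)"
    by (rule below_prob_le_prod) (use sum1 in \<open>auto simp: q_def\<close>)
  also have "\<dots> = (\<Prod>s\<in>{1..k}. prob {\<omega>\<in>space M. real (hits (E s) m (m + n) \<omega>) < x s})"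
    by (rule prod.cong[OF refl], subst pr[symmetric]) auto
  finally show ?thesis using pr[of "{1..k}"] by simp
qed

lemma hits_split: "m \<le> k \<Longrightarrow> k \<le> n \<Longrightarrow> hits E m n \<omega> = hits E m k \<omega> + hits E k n \<omega>"
  unfolding hits_def
  by (subst card_Un_disjoint[symmetric]) (auto intro!: arg_cong[where f = card])

lemma hits_Un: "E \<inter> E' = {} \<Longrightarrow> hits (E \<union> E') m n \<omega> = hits E m n \<omega> + hits E' m n \<omega>"
  unfolding hits_def
  by (subst card_Un_disjoint[symmetric]) (auto intro!: arg_cong[where f = card])

end

section \<open>Taylor expansion with one-sided derivatives\<close>

abbreviation deriv_within :: "real set \<Rightarrow> (real \<Rightarrow> real) \<Rightarrow> real \<Rightarrow> real" where
  "deriv_within S f \<equiv> (\<lambda>x. vector_derivative f (at x within S))"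

text \<open>The higher derivatives are defined by differentiating the previous derivative. The induction for Taylor's
  theorem instead applies its hypothesis to the first derivative, which this lemma and the next one allow.\<close>

lemma higher_deriv_within_Suc_left:
  "higher_deriv_within S f (Suc k) = higher_deriv_within S (deriv_within S f) k"
proof (induction k)
  case 0
  have *: "higher_deriv_within S g 0 = g" for g by (simp add: fun_eq_iff)
  show ?case unfolding * by (rule ext) (simp add: *)
next
  case (Suc k)
  have "higher_deriv_within S f (Suc (Suc k)) =
      deriv_within S (higher_deriv_within S f (Suc k))" by (simp add: fun_eq_iff)
  also have "\<dots> = higher_deriv_within S (deriv_within S f) (Suc k)"
    unfolding Suc by (simp add: fun_eq_iff)
  finally show ?case .
qed

lemma times_differentiable_within_Suc_left:
  assumes "times_differentiable_within S f (Suc (Suc k)) a"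
  shows "times_differentiable_within S (deriv_within S f) (Suc k) a \<and>
    (\<forall>\<^sub>F x in nhds a. x \<in> S \<longrightarrow> f differentiable (at x within S))"
  using assms
proof (induction k arbitrary: a)
  case 0
  have *: "higher_deriv_within S g 0 = g" for g by (simp add: fun_eq_iff)
  have "higher_deriv_within S f (Suc 0) differentiable (at a within S)"
    using 0 by simp
  hence "deriv_within S f differentiable (at a within S)"
    by (simp add: higher_deriv_within_Suc_left *)
  moreover have "\<forall>\<^sub>F x in nhds a. x \<in> S \<longrightarrow> f differentiable (at x within S)"
    using 0 by (auto simp: * elim!: eventually_mono)
  ultimately show ?case by (simp add: *)
next
  case (Suc k)
  let ?T = "times_differentiable_within"
  have 1: "\<forall>\<^sub>F x in nhds a. x \<in> S \<longrightarrow> ?T S f (Suc (Suc k)) x"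
    and 2: "higher_deriv_within S f (Suc (Suc k)) differentiable (at a within S)"
    using Suc.prems by (simp_all only: times_differentiable_within.simps(2)[of S f "Suc (Suc k)"])
  have 3: "\<forall>\<^sub>F x in nhds a. x \<in> S \<longrightarrow> ?T S (deriv_within S f) (Suc k) x"
    using 1 by (rule eventually_mono) (use Suc.IH in blast)
  have 4: "\<forall>\<^sub>F x in nhds a. x \<in> S \<longrightarrow> f differentiable (at x within S)"
  proof -
    have "\<forall>\<^sub>F x in nhds a. x \<in> S \<longrightarrow> (\<forall>\<^sub>F y in nhds x. y \<in> S \<longrightarrow> f differentiable (at y within S))"
      using 1 by (rule eventually_mono) (use Suc.IH in blast)
    thus ?thesis by (rule eventually_mono) (auto dest: eventually_nhds_x_imp_x)
  qed
  show ?case using 3 4 2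
    by (simp only: times_differentiable_within.simps(2)[of S "deriv_within S f" "Suc k"]
        higher_deriv_within_Suc_left[of S f "Suc k"])
qed

lemma times_differentiable_within_le:
  assumes "times_differentiable_within S f k a" "a \<in> S" "j \<le> k"
  shows "times_differentiable_within S f j a"
  using assms(3,1)
proof (induction k rule: dec_induct)
  case (step n)
  have "\<forall>\<^sub>F x in nhds a. x \<in> S \<longrightarrow> times_differentiable_within S f n x"
    using step.prems by simp
  hence "times_differentiable_within S f n a"
    using assms(2) eventually_nhds_x_imp_x by blast
  thus ?case by (rule step.IH)
qed simp

lemma vector_derivative_within_unit:
  assumes "f differentiable (at x within {0..1::real})" "x \<in> {0..1}"
  shows "(f has_real_derivative vector_derivative f (at x within {0..1})) (at x within {0..1})"
proof -
  have "(f has_vector_derivative vector_derivative f (at x within {0..1})) (at x within {0..1})"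
    using assms(1) by (simp add: vector_derivative_works)
  thus ?thesis by (simp add: has_real_derivative_iff_has_vector_derivative)
qed

text \<open>Taylor's theorem with Peano remainder. If the remainder of the derivative is at most \<open>e x\<^sup>k\<^sup>+\<^sup>1\<close> near 0, then the
  mean value theorem bounds the remainder of the function by \<open>e x\<^sup>k\<^sup>+\<^sup>1\<close> times \<open>x\<close>.\<close>

lemma taylor_peano:
  assumes "times_differentiable_within {0..1} f (Suc k) 0" "0 < e"
  shows "\<exists>d>0. \<forall>x\<in>{0..1}. x < d \<longrightarrow>
    \<bar>f x - (\<Sum>i\<le>Suc k. higher_deriv_within {0..1} f i 0 / fact i * x ^ i)\<bar> \<le> e * x ^ Suc k"
  using assms(1)
proof (induction k arbitrary: f)
  case 0
  define D where "D = deriv_within {0..1} f 0"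
  have f0: "higher_deriv_within {0..1} f 0 = f" by (simp add: fun_eq_iff)
  have "f differentiable (at 0 within {0..1})" using 0 by (simp add: f0)
  hence "(f has_real_derivative D) (at 0 within {0..1})"
    unfolding D_def by (rule vector_derivative_within_unit) simp
  hence "((\<lambda>y. (f y - f 0) / (y - 0)) \<longlongrightarrow> D) (at 0 within {0..1})"
    by (simp add: has_field_derivative_iff)
  hence "\<forall>\<^sub>F y in at 0 within {0..1}. dist ((f y - f 0) / (y - 0)) D < e"
    using assms(2) by (rule tendstoD)
  then obtain d where d: "d > 0"
    "\<And>y. y \<in> {0..1} \<Longrightarrow> y \<noteq> 0 \<Longrightarrow> dist y 0 < d \<Longrightarrow> dist ((f y - f 0) / (y - 0)) D < e"
    unfolding eventually_at by auto
  have "\<bar>f x - (f 0 + D * x)\<bar> \<le> e * x" if x: "x \<in> {0..1}" "x < d" for x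
  proof (cases "x = 0")
    case False
    hence x0: "x > 0" using x by auto
    have "\<bar>(f x - f 0) / x - D\<bar> < e"
      using d(2)[OF x(1) False] x x0 by (simp add: dist_real_def)
    moreover have "f x - (f 0 + D * x) = ((f x - f 0) / x - D) * x" using x0 by (simp add: field_simps)
    ultimately show ?thesis using x0 by (simp add: abs_mult)
  qed simp
  thus ?case using d(1) by (intro exI[of _ d]) (auto simp: f0 D_def)
next
  case (Suc k)
  let ?g = "deriv_within {0..1} f"
  have g: "times_differentiable_within {0..1} ?g (Suc k) 0"
    and ev: "\<forall>\<^sub>F x in nhds 0. x \<in> {0..1} \<longrightarrow> f differentiable (at x within {0..1})"
    using times_differentiable_within_Suc_left[OF Suc.prems] by auto
  obtain d1 where d1: "d1 > 0" and T: "\<And>x. x \<in> {0..1} \<Longrightarrow> x < d1 \<Longrightarrow>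
    \<bar>?g x - (\<Sum>i\<le>Suc k. higher_deriv_within {0..1} ?g i 0 / fact i * x ^ i)\<bar> \<le> e * x ^ Suc k"
    using Suc.IH[OF g] by blast
  obtain d2 where d2: "d2 > 0" and diff: "\<And>x. x \<in> {0..1} \<Longrightarrow> x < d2 \<Longrightarrow> f differentiable (at x within {0..1})"
    using ev unfolding eventually_nhds_metric by (auto simp: dist_real_def)
  define a where "a = (\<lambda>i. higher_deriv_within {0..1} f i 0)"
  define \<phi> where "\<phi> = (\<lambda>x. f x - (\<Sum>i\<le>Suc (Suc k). a i / fact i * x ^ i))"
  define \<psi> where "\<psi> = (\<lambda>x. ?g x - (\<Sum>i\<le>Suc k. a (Suc i) / fact i * x ^ i))"
  have \<psi>: "\<bar>\<psi> x\<bar> \<le> e * x ^ Suc k" if "x \<in> {0..1}" "x < d1" for x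
    using T[OF that] unfolding \<psi>_def a_def higher_deriv_within_Suc_left .
  have der: "(\<phi> has_real_derivative \<psi> x) (at x within {0..1})" if "x \<in> {0..1}" "x < d2" for x
  proof -
    have "((\<lambda>x. \<Sum>i\<le>Suc (Suc k). a i / fact i * x ^ i) has_real_derivative
        (\<Sum>i\<le>Suc (Suc k). a i / fact i * (real i * x ^ (i - 1)))) (at x within {0..1})"
      by (rule DERIV_sum) (auto intro!: derivative_eq_intros)
    also have "(\<Sum>i\<le>Suc (Suc k). a i / fact i * (real i * x ^ (i - 1))) = (\<Sum>i\<le>Suc k. a (Suc i) / fact i * x ^ i)"
      unfolding sum.atMost_Suc_shift[of _ "Suc k"]
      by (simp del: sum.atMost_Suc)
    finally show ?thesis unfolding \<phi>_def \<psi>_def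
      using vector_derivative_within_unit[OF diff[OF that] that(1)] by (intro derivative_intros)
  qed
  have "\<phi> 0 = 0" unfolding \<phi>_def by (simp add: a_def sum.atMost_Suc_shift del: sum.atMost_Suc)
  have "\<bar>\<phi> x\<bar> \<le> e * x ^ Suc (Suc k)" if x: "x \<in> {0..1}" "x < min d1 d2" for x
  proof (cases "x = 0")
    case True
    thus ?thesis using \<open>\<phi> 0 = 0\<close> by simp
  next
    case False
    hence x0: "0 < x" using x by auto
    have "norm (\<phi> x - \<phi> 0) \<le> e * x ^ Suc k * norm (x - 0)"
    proof (rule field_differentiable_bound[where S = "{0..x}" and f' = \<psi>])
      fix z assume z: "z \<in> {0..x}"
      hence "z \<in> {0..1}" "z < d1" "z < d2" using x by auto
      show "(\<phi> has_real_derivative \<psi> z) (at z within {0..x})"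
        using der[of z] z x by (auto intro: has_field_derivative_subset)
      have "\<bar>\<psi> z\<bar> \<le> e * z ^ Suc k" by (rule \<psi>) fact+
      also have "\<dots> \<le> e * x ^ Suc k" using z assms(2) by (intro mult_left_mono power_mono) auto
      finally show "norm (\<psi> z) \<le> e * x ^ Suc k" by simp
    qed (use x0 in auto)
    thus ?thesis using x0 \<open>\<phi> 0 = 0\<close> by (simp add: mult_ac)
  qed
  thus ?case unfolding \<phi>_def a_def using d1 d2 by (intro exI[of _ "min d1 d2"]) auto
qed

section \<open>The Benjamini-Hochberg procedure in terms of counts\<close>

definition num_le :: "(nat \<Rightarrow> real) \<Rightarrow> nat \<Rightarrow> real \<Rightarrow> nat" where
  "num_le x n u = card {j. j < n \<and> x j \<le> u}"

lemma num_le_mono: "u \<le> v \<Longrightarrow> num_le x n u \<le> num_le x n v"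
  unfolding num_le_def by (intro card_mono) auto

lemma num_le_le: "num_le x n u \<le> n"
proof -
  have "card {j. j < n \<and> x j \<le> u} \<le> card {..<n}" by (intro card_mono) auto
  thus ?thesis by (simp add: num_le_def)
qed

lemma sorted_nth_le_iff:
  fixes ys :: "real list"
  assumes "sorted ys" "i < length ys"
  shows "ys ! i \<le> u \<longleftrightarrow> i < length (filter (\<lambda>y. y \<le> u) ys)"
proof -
  have eq: "length (filter (\<lambda>y. y \<le> u) ys) = card {j. j < length ys \<and> ys ! j \<le> u}"
    by (simp add: length_filter_conv_card)
  show ?thesis
  proof
    assume *: "ys ! i \<le> u"
    have "{..i} \<subseteq> {j. j < length ys \<and> ys ! j \<le> u}"
      using sorted_nth_mono[OF assms(1) _ assms(2)] assms(2) * by fastforce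
    hence "card {..i} \<le> card {j. j < length ys \<and> ys ! j \<le> u}" by (intro card_mono) auto
    thus "i < length (filter (\<lambda>y. y \<le> u) ys)" unfolding eq by simp
  next
    assume *: "i < length (filter (\<lambda>y. y \<le> u) ys)"
    show "ys ! i \<le> u"
    proof (rule ccontr)
      assume "\<not> ys ! i \<le> u"
      hence "{j. j < length ys \<and> ys ! j \<le> u} \<subseteq> {..<i}"
        using sorted_nth_mono[OF assms(1)] by (fastforce simp: not_le)
      hence "card {j. j < length ys \<and> ys ! j \<le> u} \<le> card {..<i}" by (intro card_mono) auto
      thus False using * unfolding eq by simp
    qed
  qed
qed

lemma order_stat_le_iff:
  assumes "1 \<le> j" "j \<le> n"
  shows "order_stat x n j \<le> u \<longleftrightarrow> j \<le> num_le x n u"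
proof -
  have "length (filter (\<lambda>y. y \<le> u) (sort (map x [0..<n]))) = num_le x n u"
  proof -
    have "length (filter (\<lambda>y. y \<le> u) (sort (map x [0..<n]))) = length (filter (\<lambda>y. y \<le> u) (map x [0..<n]))"
      by (simp add: filter_sort)
    also have "\<dots> = num_le x n u"
      unfolding num_le_def length_filter_conv_card by (intro arg_cong[where f = card]) auto
    finally show ?thesis .
  qed
  thus ?thesis
    using sorted_nth_le_iff[of "sort (map x [0..<n])" "j - 1" u] assms by (auto simp: order_stat_def)
qed

lemma BH_R_eq: "BH_R \<alpha> x n = Max {j\<in>{0..n}. j = 0 \<or> j \<le> num_le x n (\<alpha> * real j / real n)}"
proof -
  have "{j\<in>{0..n}. order_stat x n j \<le> \<alpha> * real j / real n} =
    {j\<in>{0..n}. j = 0 \<or> j \<le> num_le x n (\<alpha> * real j / real n)}"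
    using order_stat_le_iff[of _ n x] by (force simp: order_stat_def)
  thus ?thesis by (simp add: BH_R_def)
qed

lemma BH_R_le: "BH_R \<alpha> x n \<le> n"
  unfolding BH_R_eq by (subst Max_le_iff) auto

lemma le_BH_R: "j \<le> n \<Longrightarrow> j \<le> num_le x n (\<alpha> * real j / real n) \<Longrightarrow> j \<le> BH_R \<alpha> x n"
  unfolding BH_R_eq by (rule Max_ge) auto

lemma BH_R_le_num_le: "BH_R \<alpha> x n \<le> num_le x n (\<alpha> * real (BH_R \<alpha> x n) / real n)"
proof -
  have "BH_R \<alpha> x n \<in> {j\<in>{0..n}. j = 0 \<or> j \<le> num_le x n (\<alpha> * real j / real n)}"
    unfolding BH_R_eq by (rule Max_in) auto
  thus ?thesis by auto
qed

text \<open>If more than \<open>R\<close> observations lay below the threshold for \<open>R\<close>, their number \<open>k\<close> would satisfy the BH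
  condition as well, against the maximality of \<open>R\<close>.\<close>

lemma num_le_at_BH_R:
  assumes "0 \<le> \<alpha>"
  shows "num_le x n (\<alpha> * real (BH_R \<alpha> x n) / real n) = BH_R \<alpha> x n"
proof (rule antisym)
  define k where "k = num_le x n (\<alpha> * real (BH_R \<alpha> x n) / real n)"
  have "BH_R \<alpha> x n \<le> k" unfolding k_def by (rule BH_R_le_num_le)
  hence "\<alpha> * real (BH_R \<alpha> x n) / real n \<le> \<alpha> * real k / real n"
    using assms by (intro divide_right_mono mult_left_mono) auto
  hence "k \<le> num_le x n (\<alpha> * real k / real n)" unfolding k_def by (rule num_le_mono)
  thus "k \<le> BH_R \<alpha> x n" using num_le_le[of x n] by (intro le_BH_R) (auto simp: k_def)
qed (rule BH_R_le_num_le)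

text \<open>The count \<open>k\<close> at \<open>u\<close> is itself an admissible rank: the threshold for \<open>k\<close> is at least \<open>u\<close>.\<close>

lemma num_le_le_BH_R:
  assumes "0 < \<alpha>" "0 < n" "real n * u \<le> \<alpha> * real (num_le x n u)"
  shows "num_le x n u \<le> BH_R \<alpha> x n"
proof (rule le_BH_R[OF num_le_le])
  have "u \<le> \<alpha> * real (num_le x n u) / real n" using assms by (simp add: field_simps)
  thus "num_le x n u \<le> num_le x n (\<alpha> * real (num_le x n u) / real n)" by (rule num_le_mono)
qed

text \<open>The random cut-off at the \<open>R\<close>-th order statistic may be replaced by the BH threshold: both sets of rejected
  hypotheses have \<open>R\<close> elements and one contains the other.\<close>

lemma BH_V_eq:
  assumes "0 \<le> \<alpha>" "1 \<le> BH_R \<alpha> x n"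
  shows "BH_V \<alpha> x t n = card {j. j < n \<and> x j \<le> \<alpha> * real (BH_R \<alpha> x n) / real n \<and> \<not> t j}"
proof -
  let ?R = "BH_R \<alpha> x n"
  let ?o = "order_stat x n ?R"
  let ?A = "{j. j < n \<and> x j \<le> ?o}" and ?B = "{j. j < n \<and> x j \<le> \<alpha> * real ?R / real n}"
  have "?o \<le> \<alpha> * real ?R / real n"
    unfolding order_stat_le_iff[OF assms(2) BH_R_le] by (rule BH_R_le_num_le)
  hence sub: "?A \<subseteq> ?B" by auto
  have "?R \<le> card ?A"
    using order_stat_le_iff[OF assms(2) BH_R_le, of x ?o] by (simp add: num_le_def)
  hence "card ?B \<le> card ?A" using num_le_at_BH_R[OF assms(1), of x n] by (simp add: num_le_def)
  hence "?A = ?B" using sub by (intro card_seteq) auto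
  hence "{j. j < n \<and> x j \<le> ?o \<and> \<not> t j} = {j. j < n \<and> x j \<le> \<alpha> * real ?R / real n \<and> \<not> t j}"
    by blast
  thus ?thesis unfolding BH_V_def by simp
qed

section \<open>The random effects model\<close>

lemma (in prob_space) AE_eventually_not_in:
  assumes "\<And>n. A n \<in> events" and b: "\<forall>\<^sub>F n in sequentially. prob (A n) \<le> b n" "summable b"
  shows "AE \<omega> in M. \<forall>\<^sub>F n in sequentially. \<omega> \<notin> A n"
proof -
  have "summable (\<lambda>n. prob (A n))"
    by (rule summable_comparison_test_ev[OF _ b(2)]) (use b(1) in simp)
  hence "AE \<omega> in M. \<forall>\<^sub>F n in sequentially. \<omega> \<in> space M - A n"
    by (intro borel_cantelli_AE1) (use assms in \<open>auto simp: emeasure_eq_measure\<close>)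
  thus ?thesis by (rule AE_mp) (auto intro!: AE_I2 elim!: eventually_mono)
qed

abbreviation pair_algebra :: "(real \<times> bool) measure" where
  "pair_algebra \<equiv> borel \<Otimes>\<^sub>M count_space UNIV"

definition low :: "real \<Rightarrow> (real \<times> bool) set" where
  "low u = {z. fst z \<le> u}"

definition null_low :: "real \<Rightarrow> (real \<times> bool) set" where
  "null_low u = {z. fst z \<le> u \<and> \<not> snd z}"

lemma low_sets [measurable]: "low u \<in> sets pair_algebra" "null_low u \<in> sets pair_algebra"
proof -
  have "{z\<in>space pair_algebra. fst z \<le> u} \<in> sets pair_algebra"
    "{z\<in>space pair_algebra. fst z \<le> u \<and> \<not> snd z} \<in> sets pair_algebra" by measurable
  thus "low u \<in> sets pair_algebra" "null_low u \<in> sets pair_algebra"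
    by (simp_all add: low_def null_low_def space_pair_measure)
qed

context random_effects_model
begin

abbreviation "F \<equiv> pval_cdf \<pi> G"

sublocale iid_sequence M "\<lambda>j \<omega>. (p j \<omega>, \<theta> j \<omega>)" pair_algebra
  by unfold_locales (rule indep, rule ident)

lemma p_measurable [measurable]: "p j \<in> borel_measurable M"
  using measurable_compose[OF X_measurable measurable_fst, of j] by simp

lemma theta_measurable [measurable]: "\<theta> j \<in> measurable M (count_space UNIV)"
  using measurable_compose[OF X_measurable measurable_snd, of j] by simp

lemma prob_not_theta: "prob {\<omega>\<in>space M. \<not> \<theta> j \<omega>} = 1 - \<pi>"
proof -
  have "{\<omega>\<in>space M. \<not> \<theta> j \<omega>} = space M - {\<omega>\<in>space M. \<theta> j \<omega>}" by auto
  moreover have "{\<omega>\<in>space M. \<theta> j \<omega>} \<in> events" by measurable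
  ultimately show ?thesis using theta_prob[of j] by (simp add: prob_compl)
qed

lemma prob_null_low:
  assumes "u \<in> {0..1}"
  shows "prob {\<omega>\<in>space M. p j \<omega> \<le> u \<and> \<not> \<theta> j \<omega>} = (1 - \<pi>) * u"
  using p_null[OF assms, of j] pi_range prob_not_theta[of j]
  by (simp add: cond_prob_def field_simps)

lemma prob_alt_low:
  assumes "u \<in> {0..1}"
  shows "prob {\<omega>\<in>space M. p j \<omega> \<le> u \<and> \<theta> j \<omega>} = \<pi> * G u"
  using p_alt[OF assms, of j] pi_range theta_prob[of j]
  by (simp add: cond_prob_def field_simps)

lemma prob_low:
  assumes "u \<in> {0..1}"
  shows "prob {\<omega>\<in>space M. p j \<omega> \<le> u} = F u"
proof -
  have "prob {\<omega>\<in>space M. p j \<omega> \<le> u} = prob ({\<omega>\<in>space M. p j \<omega> \<le> u \<and> \<not> \<theta> j \<omega>} \<union> {\<omega>\<in>space M. p j \<omega> \<le> u \<and> \<theta> j \<omega>})"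
    by (rule arg_cong[where f = prob]) auto
  also have "\<dots> = prob {\<omega>\<in>space M. p j \<omega> \<le> u \<and> \<not> \<theta> j \<omega>} + prob {\<omega>\<in>space M. p j \<omega> \<le> u \<and> \<theta> j \<omega>}"
    by (rule finite_measure_Union) auto
  finally show ?thesis using assms by (simp add: prob_null_low prob_alt_low pval_cdf_def)
qed

lemma F_eq: "u \<in> {0..1} \<Longrightarrow> F u = prob {\<omega>\<in>space M. (p 0 \<omega>, \<theta> 0 \<omega>) \<in> low u}"
  using prob_low[of u 0] by (simp add: low_def)

lemma null_eq: "u \<in> {0..1} \<Longrightarrow> (1 - \<pi>) * u = prob {\<omega>\<in>space M. (p 0 \<omega>, \<theta> 0 \<omega>) \<in> null_low u}"
  using prob_null_low[of u 0] by (simp add: null_low_def)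

lemma F_1: "F 1 = 1"
proof -
  have "prob {\<omega>\<in>space M. p 0 \<omega> \<le> 1} = 1"
    using p_range[of 0] by (subst prob_Collect_eq_1) auto
  thus ?thesis using prob_low[of 1 0] by simp
qed

lemma F_lower: "u \<in> {0..1} \<Longrightarrow> (1 - \<pi>) * u \<le> F u"
  using prob_alt_low[of u 0] measure_nonneg[of M "{\<omega>\<in>space M. p 0 \<omega> \<le> u \<and> \<theta> 0 \<omega>}"]
  by (simp add: pval_cdf_def)

lemma F_pos: "u \<in> {0<..1} \<Longrightarrow> 0 < F u"
  using F_lower[of u] pi_range by (smt (verit) atLeastAtMost_iff greaterThanAtMost_iff mult_pos_pos)

lemma hits_low: "hits (low u) 0 n \<omega> = num_le (\<lambda>j. p j \<omega>) n u"
  unfolding hits_def num_le_def low_def by (rule arg_cong[where f = card]) auto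

lemma hits_null_low: "hits (null_low u) 0 n \<omega> = card {j. j < n \<and> p j \<omega> \<le> u \<and> \<not> \<theta> j \<omega>}"
  unfolding hits_def null_low_def by (rule arg_cong[where f = card]) auto

end

section \<open>The critical target level\<close>

text \<open>The critical case with the smoothness of \<open>F\<close> reduced to its consequence: \<open>F\<close> stays below its tangent of slope
  \<open>a\<close> at 0 and the gap between them is \<open>c u\<^sup>l + o(u\<^sup>l)\<close>.\<close>

locale critical_BH = random_effects_model +
  fixes a c :: real and l :: nat
  assumes l_ge_2: "2 \<le> l" and c_pos: "0 < c"
    and F_below: "u \<in> {0<..1} \<Longrightarrow> F u < a * u"
    and F_expansion: "0 < e \<Longrightarrow> \<exists>d>0. \<forall>u\<in>{0..1}. u < d \<longrightarrow> \<bar>a * u - F u - c * u ^ l\<bar> \<le> e * u ^ l"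
begin

definition nu :: real where "nu = (2 * real l - 2) / (2 * real l - 1)"

abbreviation R :: "nat \<Rightarrow> 'a \<Rightarrow> nat" where
  "R n \<omega> \<equiv> BH_R (1 / a) (\<lambda>j. p j \<omega>) n"

abbreviation V :: "nat \<Rightarrow> 'a \<Rightarrow> nat" where
  "V n \<omega> \<equiv> BH_V (1 / a) (\<lambda>j. p j \<omega>) (\<lambda>j. \<theta> j \<omega>) n"

lemma a_gt_1: "1 < a"
  using F_below[of 1] F_1 by simp

lemma real_2l: "real (2 * l - 1) = 2 * real l - 1" "real (2 * l - 2) = 2 * real l - 2"
  using l_ge_2 by (simp_all add: of_nat_diff)

lemma nu_bounds: "2 / 3 \<le> nu" "nu < 1" and nu_mult: "nu * (2 * real l - 1) = 2 * real l - 2"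
  and one_minus_nu: "1 - nu = 1 / (2 * real l - 1)"
  using l_ge_2 by (simp_all add: nu_def field_simps)

text \<open>With \<open>L = ln n\<close> this is the defining property of the threshold \<open>n\<^sup>\<nu> (ln n)\<^sup>1\<^sup>-\<^sup>\<nu>\<close>: it turns the exponent
  \<open>k\<^sup>2\<^sup>l\<^sup>-\<^sup>1 / n\<^sup>2\<^sup>l\<^sup>-\<^sup>2\<close> of \<open>prob_ge_rank\<close> into \<open>ln n\<close>. With \<open>L = 1\<close> it describes \<open>n\<^sup>\<nu>\<close>.\<close>

lemma threshold_power:
  assumes "0 < n" "0 < L"
  shows "(n powr nu * L powr (1 - nu)) ^ (2 * l - 1) = n ^ (2 * l - 2) * L"
proof -
  have "(n powr nu) ^ (2 * l - 1) = n ^ (2 * l - 2)"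
  proof -
    have "(n powr nu) ^ (2 * l - 1) = n powr (nu * real (2 * l - 1))"
      using assms by (simp add: powr_powr flip: powr_realpow)
    also have "nu * real (2 * l - 1) = real (2 * l - 2)" by (simp only: real_2l nu_mult)
    finally show ?thesis using assms by (simp only: powr_realpow)
  qed
  moreover have "(L powr (1 - nu)) ^ (2 * l - 1) = L"
    using assms real_2l one_minus_nu l_ge_2 by (simp add: powr_power)
  ultimately show ?thesis by (simp add: power_mult_distrib)
qed

text \<open>Near 0 this is the expansion of the gap; away from 0 the gap is continuous and positive on a compact
  interval. The constant is worse than \<open>c\<close>, but valid for all \<open>u\<close>.\<close>

lemma gap_lower_global: "\<exists>c'>0. \<forall>u\<in>{0<..1}. c' * u ^ l \<le> a * u - F u"
proof -
  obtain d where d: "d > 0" "\<And>u. u \<in> {0..1} \<Longrightarrow> u < d \<Longrightarrow> \<bar>a * u - F u - c * u ^ l\<bar> \<le> c / 2 * u ^ l"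
    using F_expansion[of "c / 2"] c_pos by auto
  define d' where "d' = min d 1"
  have "continuous_on {d'..1} (\<lambda>u. a * u - F u)"
    by (intro continuous_intros continuous_on_subset[OF cdf_cont]) (use d in \<open>auto simp: d'_def\<close>)
  then obtain u0 where u0: "u0 \<in> {d'..1}" "\<And>u. u \<in> {d'..1} \<Longrightarrow> a * u0 - F u0 \<le> a * u - F u"
    using continuous_attains_inf[of "{d'..1}" "\<lambda>u. a * u - F u"] by (auto simp: d'_def)
  define m where "m = a * u0 - F u0"
  have m: "m > 0" unfolding m_def using F_below[of u0] u0(1) d(1) by (auto simp: d'_def)
  have "min (c / 2) m * u ^ l \<le> a * u - F u" if u: "u \<in> {0<..1}" for u
  proof (cases "u < d")
    case True
    have "c * u ^ l - c / 2 * u ^ l \<le> a * u - F u" using abs_le_D2[OF d(2)[of u]] u True by simp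
    hence "c / 2 * u ^ l \<le> a * u - F u" by simp
    moreover have "min (c / 2) m * u ^ l \<le> c / 2 * u ^ l" using u by (intro mult_right_mono) auto
    ultimately show ?thesis by linarith
  next
    case False
    have "min (c / 2) m * u ^ l \<le> m * 1"
      using u m c_pos by (intro mult_mono power_le_one) auto
    also have "m * 1 \<le> a * u - F u" using u0(2)[of u] u False by (auto simp: m_def d'_def)
    finally show ?thesis .
  qed
  thus ?thesis using m c_pos by (intro exI[of _ "min (c / 2) m"]) auto
qed

text \<open>The upper tail bound at \<open>u = k / (a n)\<close>, where the tangent has height \<open>k / n\<close>, with the gap bounded below by
  \<open>b u\<^sup>l\<close>.\<close>

lemma prob_ge_rank:
  assumes k: "1 \<le> k" "k \<le> n"
    and b: "0 \<le> b" "b * (real k / (a * real n)) ^ l \<le> a * (real k / (a * real n)) - F (real k / (a * real n))"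
  shows "prob {\<omega>\<in>space M. k \<le> hits (low (real k / (a * real n))) 0 n \<omega>}
    \<le> exp (- (b\<^sup>2 / (2 * a ^ (2 * l)) * (real k ^ (2 * l - 1) / real n ^ (2 * l - 2))))"
proof -
  define u where "u = real k / (a * real n)"
  have n: "real n > 0" using k by simp
  have u: "u \<in> {0<..1}"
  proof -
    have "real k * 1 \<le> real n * a" using k a_gt_1 by (intro mult_mono) auto
    thus ?thesis unfolding u_def using k a_gt_1 n by (auto simp: field_simps)
  qed
  have au: "a * u = real k / real n" using a_gt_1 by (simp add: u_def)
  have "prob {\<omega>\<in>space M. real n * (a * u) \<le> real (hits (low u) 0 (0 + n) \<omega>)}
    \<le> exp (- (real n * (a * u - F u)\<^sup>2 / (2 * (a * u))))"
    by (rule hits_upper_tail) (use u F_eq[of u] F_below[of u] F_pos[of u] in auto)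
  also have "\<dots> \<le> exp (- (real n * (b * u ^ l)\<^sup>2 / (2 * (a * u))))"
  proof -
    have "(b * u ^ l)\<^sup>2 \<le> (a * u - F u)\<^sup>2" using b u unfolding u_def[symmetric] by (intro power_mono) auto
    thus ?thesis using u a_gt_1 by (auto intro!: divide_right_mono mult_left_mono)
  qed
  also have "real n * (b * u ^ l)\<^sup>2 / (2 * (a * u)) =
     b\<^sup>2 / (2 * a ^ (2 * l)) * (real k ^ (2 * l - 1) / real n ^ (2 * l - 2))"
  proof -
    obtain l' where l': "l = Suc l'" using l_ge_2 by (cases l) auto
    show ?thesis unfolding au unfolding u_def l' using n a_gt_1 k
      by (simp add: field_simps power_mult_distrib power_divide power2_eq_square flip: power_add mult_2)
  qed
  also have "real n * (a * u) = real k" using n by (simp add: au)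
  finally show ?thesis by (simp add: u_def)
qed

end

section \<open>The upper bound for the number of rejections\<close>

context critical_BH
begin

text \<open>Union bound over the ranks \<open>k\<close> above the threshold. For \<open>k\<close> up to \<open>n\<^sup>\<nu> ln n\<close> the cut-off \<open>k/(a n)\<close> tends to 0, so the
  gap constant may be taken as any \<open>c1 < c\<close>; each of these at most \<open>n\<^sup>\<nu> ln n\<close> ranks contributes \<open>n\<^sup>-\<^sup>B\<close> with
  \<open>B > 1 + \<nu>\<close>. For larger \<open>k\<close> the exponent has an additional power of \<open>ln n\<close>, so that the global gap constant
  suffices for a bound \<open>n\<^sup>-\<^sup>3\<close>.\<close>

lemma upper_bound_AE:
  assumes \<kappa>: "0 < \<kappa>" "1 + nu < c\<^sup>2 / (2 * a ^ (2 * l)) * \<kappa> ^ (2 * l - 1)"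
  shows "AE \<omega> in M. \<forall>\<^sub>F n in sequentially.
           real (R n \<omega>) < \<kappa> * (real n powr nu * ln (real n) powr (1 - nu))"
proof -
  define C where "C = (\<lambda>b. b\<^sup>2 / (2 * a ^ (2 * l)))"
  have a0: "a > 0" using a_gt_1 by simp
  have "1 + nu < C c * \<kappa> ^ (2 * l - 1)" using \<kappa>(2) by (simp add: C_def)
  moreover have "((\<lambda>b. C b * \<kappa> ^ (2 * l - 1)) \<longlongrightarrow> C c * \<kappa> ^ (2 * l - 1)) (at_left c)"
    unfolding C_def by (intro tendsto_intros) (use a0 in auto)
  ultimately have "\<forall>\<^sub>F b in at_left c. 1 + nu < C b * \<kappa> ^ (2 * l - 1)"
    by (rule order_tendstoD(1)[rotated])
  moreover have "\<forall>\<^sub>F b in at_left c. 0 < b \<and> b < c"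
    using c_pos eventually_at_left_real[of 0 c] by (auto elim!: eventually_mono)
  ultimately have "\<forall>\<^sub>F b in at_left c. 1 + nu < C b * \<kappa> ^ (2 * l - 1) \<and> 0 < b \<and> b < c"
    by eventually_elim auto
  then obtain c1 where c1: "0 < c1" "c1 < c" "1 + nu < C c1 * \<kappa> ^ (2 * l - 1)"
    using eventually_happens[of _ "at_left c"] by auto
  \<comment> \<open>A slightly smaller gap constant than \<open>c\<close> still leaves the exponent \<open>B\<close> above \<open>1 + \<nu>\<close>.\<close>
  define B where "B = C c1 * \<kappa> ^ (2 * l - 1)"
  obtain d where d: "d > 0" "\<And>u. u \<in> {0..1} \<Longrightarrow> u < d \<Longrightarrow> \<bar>a * u - F u - c * u ^ l\<bar> \<le> (c - c1) * u ^ l"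
    using F_expansion[of "c - c1"] c1 by auto
  obtain c' where c': "c' > 0" "\<And>u. u \<in> {0<..1} \<Longrightarrow> c' * u ^ l \<le> a * u - F u"
    using gap_lower_global by auto
  define y where "y = (\<lambda>n. real n powr nu * ln (real n))"
  define x where "x = (\<lambda>n. \<kappa> * (real n powr nu * ln (real n) powr (1 - nu)))"
  define u where "u = (\<lambda>n k. real k / (a * real n))"
  define K where "K = (\<lambda>n. {k\<in>{1..n}. x n \<le> real k})"
  define A where "A = (\<lambda>n. \<Union>k\<in>K n. {\<omega>\<in>space M. k \<le> hits (low (u n k)) 0 n \<omega>})"
  have finK: "finite (K n)" for n unfolding K_def by auto
  have ev_A: "{\<omega>\<in>space M. k \<le> hits (low (u n k)) 0 n \<omega>} \<in> events" for n k
    by measurable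
  have "\<forall>\<^sub>F n in sequentially. prob (A n) \<le> y n * real n powr (- B) + real n * real n powr (- 3)"
  proof -
    have "(\<lambda>n. y n / (a * real n)) \<longlonglongrightarrow> 0"
      unfolding y_def using nu_bounds a0 by real_asymp
    hence "\<forall>\<^sub>F n in sequentially. y n / (a * real n) < d"
      using d(1) by (rule order_tendstoD(2))
    moreover have "filterlim (\<lambda>n. C c' * ln (real n) ^ 2) at_top sequentially"
    proof -
      have "C c' > 0" using c' a0 by (simp add: C_def)
      thus ?thesis by real_asymp
    qed
    hence "\<forall>\<^sub>F n in sequentially. 3 \<le> C c' * ln (real n) ^ 2"
      by (simp add: filterlim_at_top)
    moreover have "\<forall>\<^sub>F n in sequentially. 1 \<le> ln (real n)" by real_asymp
    ultimately show ?thesis using eventually_gt_at_top[of 0]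
    proof eventually_elim
      case (elim n)
      have n: "real n > 0" using elim by simp
      have L0: "0 < ln (real n)" using elim by linarith
      have y0: "y n \<ge> 0" using elim unfolding y_def by auto
      have uk: "u n k \<in> {0<..1}" if "k \<in> K n" for k
      proof -
        have "real k * 1 \<le> real n * a" using that a_gt_1 unfolding K_def by (intro mult_mono) auto
        thus ?thesis unfolding u_def using that a_gt_1 n by (auto simp: field_simps K_def)
      qed
      have small: "prob {\<omega>\<in>space M. k \<le> hits (low (u n k)) 0 n \<omega>} \<le> real n powr (- B)"
        if k: "k \<in> K n" "real k < y n" for k
      proof -
        have "u n k < y n / (a * real n)" unfolding u_def using k n a0 by (intro divide_strict_right_mono) auto
        hence "\<bar>a * u n k - F (u n k) - c * u n k ^ l\<bar> \<le> (c - c1) * u n k ^ l"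
          using d(2)[of "u n k"] uk[OF k(1)] elim by auto
        hence "c1 * u n k ^ l \<le> a * u n k - F (u n k)" by (auto simp: algebra_simps abs_le_iff)
        hence "prob {\<omega>\<in>space M. k \<le> hits (low (u n k)) 0 n \<omega>}
          \<le> exp (- (C c1 * (real k ^ (2 * l - 1) / real n ^ (2 * l - 2))))"
          unfolding u_def C_def using k c1 by (intro prob_ge_rank) (auto simp: K_def)
        also have "\<dots> \<le> exp (- (B * ln (real n)))"
        proof -
          have "x n ^ (2 * l - 1) = \<kappa> ^ (2 * l - 1) * (real n ^ (2 * l - 2) * ln (real n))"
            unfolding x_def power_mult_distrib[of \<kappa>] by (simp only: threshold_power[OF n L0])
          hence "\<kappa> ^ (2 * l - 1) * ln (real n) = x n ^ (2 * l - 1) / real n ^ (2 * l - 2)"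
            using n by simp
          also have "\<dots> \<le> real k ^ (2 * l - 1) / real n ^ (2 * l - 2)"
            using k(1) \<kappa>(1) by (intro divide_right_mono power_mono) (auto simp: K_def x_def)
          finally have "C c1 * (\<kappa> ^ (2 * l - 1) * ln (real n)) \<le> C c1 * (real k ^ (2 * l - 1) / real n ^ (2 * l - 2))"
            by (rule mult_left_mono) (use a0 in \<open>simp add: C_def\<close>)
          thus ?thesis by (simp add: B_def mult_ac)
        qed
        also have "\<dots> = real n powr (- B)" using n by (simp add: powr_def)
        finally show ?thesis .
      qed
      have large: "prob {\<omega>\<in>space M. k \<le> hits (low (u n k)) 0 n \<omega>} \<le> real n powr (- 3)"
        if k: "k \<in> K n" "y n \<le> real k" for k
      proof -
        have "prob {\<omega>\<in>space M. k \<le> hits (low (u n k)) 0 n \<omega>}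
          \<le> exp (- (C c' * (real k ^ (2 * l - 1) / real n ^ (2 * l - 2))))"
          unfolding u_def C_def using k c'(1) c'(2)[OF uk[OF k(1)], unfolded u_def]
          by (intro prob_ge_rank) (auto simp: K_def)
        also have "\<dots> \<le> exp (- (3 * ln (real n)))"
        proof -
          have "3 * ln (real n) \<le> C c' * ln (real n) ^ 2 * ln (real n)"
            using elim by (intro mult_right_mono) auto
          also have "\<dots> = C c' * ln (real n) ^ 3" by (simp add: power2_eq_square power3_eq_cube)
          also have "\<dots> \<le> C c' * ln (real n) ^ (2 * l - 1)"
            using elim l_ge_2 a0 by (intro mult_left_mono power_increasing) (auto simp: C_def)
          also have "ln (real n) ^ (2 * l - 1) = y n ^ (2 * l - 1) / real n ^ (2 * l - 2)"
            unfolding y_def power_mult_distrib using threshold_power[of "real n" 1] n by simp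
          also have "C c' * \<dots> \<le> C c' * (real k ^ (2 * l - 1) / real n ^ (2 * l - 2))"
            using k(2) y0 a0 by (intro mult_left_mono divide_right_mono power_mono) (auto simp: C_def)
          finally show ?thesis by simp
        qed
        also have "\<dots> = real n powr (- 3)" using n by (simp add: powr_def)
        finally show ?thesis .
      qed
      have "prob (A n) \<le> (\<Sum>k\<in>K n. prob {\<omega>\<in>space M. k \<le> hits (low (u n k)) 0 n \<omega>})"
        unfolding A_def by (rule finite_measure_subadditive_finite) (use finK ev_A in auto)
      also have "\<dots> \<le> (\<Sum>k\<in>K n. (if real k < y n then real n powr (- B) else 0) + real n powr (- 3))"
        using small large by (intro sum_mono) (fastforce intro: add_increasing add_increasing2)
      also have "\<dots> = real (card {k\<in>K n. real k < y n}) * real n powr (- B) + real (card (K n)) * real n powr (- 3)"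
        using finK by (simp add: sum.distrib sum.If_cases Int_def)
      also have "\<dots> \<le> y n * real n powr (- B) + real n * real n powr (- 3)"
      proof (intro add_mono mult_right_mono)
        have "{k\<in>K n. real k < y n} \<subseteq> {1..nat \<lfloor>y n\<rfloor>}"
          by (auto simp: K_def le_nat_floor)
        hence "card {k\<in>K n. real k < y n} \<le> card {1..nat \<lfloor>y n\<rfloor>}" by (intro card_mono) auto
        hence "real (card {k\<in>K n. real k < y n}) \<le> real (nat \<lfloor>y n\<rfloor>)" by simp
        also have "\<dots> \<le> y n" using y0 by (simp add: of_nat_floor)
        finally show "real (card {k\<in>K n. real k < y n}) \<le> y n" .
        have "card (K n) \<le> card {1..n}" unfolding K_def by (intro card_mono) auto
        thus "real (card (K n)) \<le> real n" by simp
      qed auto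
      finally show ?case .
    qed
  qed
  moreover have "summable (\<lambda>n. y n * real n powr (- B) + real n * real n powr (- 3))"
  proof (rule summable_comparison_test_ev)
    have B: "1 + nu < B" using c1(3) by (simp add: B_def)
    define s where "s = min 2 (1 + (B - 1 - nu) / 2)"
    have s: "s > 1" "s \<le> 2" "s \<le> 1 + (B - 1 - nu) / 2" using B by (auto simp: s_def)
    show "summable (\<lambda>n. 2 * real n powr (- s))"
      using s by (intro summable_mult) (simp add: summable_real_powr_iff)
    have "\<forall>\<^sub>F n in sequentially. y n * real n powr (- B) \<le> real n powr (- (1 + (B - 1 - nu) / 2))"
    proof -
      define h where "h = (B - 1 - nu) / 2"
      have h: "h > 0" "- B = - nu - 1 - 2 * h" using B by (auto simp: h_def field_simps)
      have "\<forall>\<^sub>F n in sequentially. ln (real n) * real n powr (- 1 - 2 * h) \<le> real n powr (- 1 - h)"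
        using h(1) by real_asymp
      moreover have "y n * real n powr (- B) = ln (real n) * real n powr (- 1 - 2 * h)" for n
        unfolding y_def h(2) by (simp add: mult_ac flip: powr_add)
      ultimately show ?thesis by (simp add: h_def)
    qed
    moreover have "\<forall>\<^sub>F n in sequentially. real n * real n powr (- 3) \<le> real n powr (- 2)"
      by (simp add: powr_mult_base)
    ultimately show "\<forall>\<^sub>F n in sequentially. norm (y n * real n powr (- B) + real n * real n powr (- 3)) \<le> 2 * real n powr (- s)"
      using eventually_ge_at_top[of 1]
    proof eventually_elim
      case (elim n)
      have "y n \<ge> 0" using elim by (simp add: y_def)
      moreover have "real n powr (- (1 + (B - 1 - nu) / 2)) \<le> real n powr (- s)" "real n powr (- 2) \<le> real n powr (- s)"
        using elim s by (auto intro!: powr_mono)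
      ultimately show ?case using elim by (simp add: abs_of_nonneg)
    qed
  qed
  ultimately have "AE \<omega> in M. \<forall>\<^sub>F n in sequentially. \<omega> \<notin> A n"
    by (intro AE_eventually_not_in) (auto simp: A_def intro!: sets.finite_UN finK ev_A)
  thus ?thesis
  proof (rule AE_mp, intro AE_I2 impI)
    fix \<omega> assume \<omega>: "\<omega> \<in> space M" and ev: "\<forall>\<^sub>F n in sequentially. \<omega> \<notin> A n"
    show "\<forall>\<^sub>F n in sequentially. real (R n \<omega>) < \<kappa> * (real n powr nu * ln (real n) powr (1 - nu))"
      using ev eventually_gt_at_top[of 1]
    proof eventually_elim
      case (elim n)
      show ?case
      proof (rule ccontr)
        assume "\<not> ?thesis"
        hence ge: "x n \<le> real (R n \<omega>)" by (simp add: x_def)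
        have "0 < x n" using elim \<kappa> by (simp add: x_def)
        hence "R n \<omega> \<in> K n" using ge BH_R_le[of "1 / a" "\<lambda>j. p j \<omega>" n] by (auto simp: K_def)
        moreover have "R n \<omega> \<le> hits (low (u n (R n \<omega>))) 0 n \<omega>"
          unfolding hits_low u_def using BH_R_le_num_le[of "1 / a" "\<lambda>j. p j \<omega>" n] by simp
        ultimately have "\<omega> \<in> A n" unfolding A_def using \<omega> by blast
        thus False using elim by simp
      qed
    qed
  qed
qed

end

section \<open>The lower bound for the number of rejections\<close>

context critical_BH
begin

text \<open>One block \<open>n0 \<le> n \<le> n1\<close> of sample sizes, with scales \<open>u 0 \<le> \<dots> \<le> u k\<close>. The count at \<open>u s\<close> for sample size \<open>n\<close> is
  the sum of three parts: the first \<open>n0\<close> observations below \<open>u (s - 1)\<close>, the first \<open>n0\<close> observations between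
  \<open>u (s - 1)\<close> and \<open>u s\<close>, and the later observations. The first and third part fall below their means by more
  than \<open>\<mu> (s - 1)\<close> and \<open>\<xi> s\<close> only with the small probabilities of the lower tail bound. The middle parts
  are negatively dependent, so that some \<open>s\<close> has an upward fluctuation of the order of the standard deviation
  except with probability \<open>(79/80)\<^sup>k\<close>. Under \<open>slack\<close> this fluctuation pays for everything else and for the gap
  between \<open>F\<close> and its tangent.\<close>

lemma block_failure:
  fixes u \<mu> \<xi> :: "nat \<Rightarrow> real" and n0 n1 k :: nat and g :: real
  defines "q \<equiv> \<lambda>s. F (u s) - F (u (s - 1))"
  assumes n: "0 < n0" "n0 \<le> n1" "real (n1 - n0) \<le> g" "0 < g"
    and u: "\<And>s. s \<le> k \<Longrightarrow> u s \<in> {0<..1}" "\<And>s t. s \<le> t \<Longrightarrow> t \<le> k \<Longrightarrow> u s \<le> u t"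
    and dev: "\<And>s. s \<le> k \<Longrightarrow> 0 \<le> \<mu> s" "\<And>s. s \<le> k \<Longrightarrow> 0 \<le> \<xi> s"
    and q: "\<And>s. s \<in> {1..k} \<Longrightarrow> q s \<le> 1 / 2" "\<And>s. s \<in> {1..k} \<Longrightarrow> 1 \<le> real n0 * q s"
    and slack: "\<And>s. s \<in> {1..k} \<Longrightarrow>
      real n1 * (a * u s - F (u s)) + \<mu> (s - 1) + \<xi> s \<le> sqrt (real n0 * q s) / 20"
  shows "\<exists>A\<in>events. (\<forall>\<omega>\<in>space M - A. \<forall>n\<in>{n0..n1}. \<exists>s\<in>{1..k}. real n * (a * u s) \<le> hits (low (u s)) 0 n \<omega>) \<and>
    prob A \<le> (79 / 80) ^ k + (\<Sum>s\<in>{..<k}. exp (- ((\<mu> s)\<^sup>2 / (2 * (real n0 * (a * u s))))))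
      + (\<Sum>s\<in>{1..k}. real (n1 - n0 + 1) * exp (- ((\<xi> s)\<^sup>2 / (2 * (g * (a * u s))))))"
proof -
  define E where "E = (\<lambda>s. low (u s) - low (u (s - 1)))"
  have E [measurable]: "E s \<in> sets pair_algebra" for s unfolding E_def by measurable
  have Fu: "F (u s) < a * u s" "0 < a * u s" if "s \<le> k" for s
    using F_below[OF u(1)[OF that]] u(1)[OF that] a_gt_1 by auto
  have disj: "disjoint_family_on E {1..k}"
  proof -
    have "E s \<inter> E t = {}" if "s \<in> {1..k}" "t \<in> {1..k}" "s < t" for s t
    proof -
      have "u s \<le> u (t - 1)" using that by (intro u) auto
      thus ?thesis by (auto simp: E_def low_def)
    qed
    thus ?thesis unfolding disjoint_family_on_def by (metis Int_commute linorder_neqE_nat)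
  qed
  have qE: "q s = prob {\<omega>\<in>space M. (p 0 \<omega>, \<theta> 0 \<omega>) \<in> E s}" if "s \<in> {1..k}" for s
  proof -
    have s: "u s \<in> {0..1}" "u (s - 1) \<in> {0..1}" "u (s - 1) \<le> u s"
      using u(1)[of s] u(1)[of "s - 1"] u(2)[of "s - 1" s] that diff_le_self[of s 1]
      by (auto dest: order_trans intro: less_imp_le)
    let ?L = "\<lambda>v. {\<omega>\<in>space M. (p 0 \<omega>, \<theta> 0 \<omega>) \<in> low v}"
    have "{\<omega>\<in>space M. (p 0 \<omega>, \<theta> 0 \<omega>) \<in> E s} = ?L (u s) - ?L (u (s - 1))"
      by (auto simp: E_def)
    moreover have "prob (?L (u s) - ?L (u (s - 1))) = prob (?L (u s)) - prob (?L (u (s - 1)))"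
      by (rule finite_measure_Diff) (use s in \<open>auto simp: low_def\<close>)
    ultimately show ?thesis using s by (simp add: q_def F_eq)
  qed
  \<comment> \<open>Events of failure: no middle part is large; a first part is too small; a third part is too small.\<close>
  define A1 where "A1 = {\<omega>\<in>space M. \<forall>s\<in>{1..k}. real (hits (E s) 0 n0 \<omega>) < real n0 * q s + sqrt (real n0 * q s) / 20}"
  define A2 where "A2 = (\<Union>s\<in>{..<k}. {\<omega>\<in>space M. real (hits (low (u s)) 0 n0 \<omega>) \<le> real n0 * F (u s) - \<mu> s})"
  define A3 where "A3 = (\<Union>s\<in>{1..k}. \<Union>n\<in>{n0..n1}.
     {\<omega>\<in>space M. real (hits (low (u s)) n0 n \<omega>) \<le> real (n - n0) * F (u s) - \<xi> s})"
  have [measurable]: "A1 \<in> events" unfolding A1_def by measurable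
  have [measurable]: "A2 \<in> events" unfolding A2_def by (intro sets.finite_UN) auto
  have [measurable]: "A3 \<in> events" unfolding A3_def by (intro sets.finite_UN) auto
  have "prob A1 \<le> (\<Prod>s\<in>{1..k}. prob {\<omega>\<in>space M. real (hits (E s) 0 n0 \<omega>) < real n0 * q s + sqrt (real n0 * q s) / 20})"
    unfolding A1_def
    using hits_negative_dependence[of k E 0 n0 "\<lambda>s. real n0 * q s + sqrt (real n0 * q s) / 20"] disj by simp
  also have "\<dots> \<le> (\<Prod>s\<in>{1..k}. 79 / 80)"
  proof (intro prod_mono conjI)
    fix s assume s: "s \<in> {1..k}"
    show "prob {\<omega>\<in>space M. real (hits (E s) 0 n0 \<omega>) < real n0 * q s + sqrt (real n0 * q s) / 20} \<le> 79 / 80"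
      using hits_anticoncentration[OF E qE[OF s] q(1)[OF s] q(2)[OF s], of 0] by simp
  qed auto
  finally have A1: "prob A1 \<le> (79 / 80) ^ k" by simp
  have "prob A2 \<le> (\<Sum>s\<in>{..<k}. prob {\<omega>\<in>space M. real (hits (low (u s)) 0 n0 \<omega>) \<le> real n0 * F (u s) - \<mu> s})"
    unfolding A2_def by (rule finite_measure_subadditive_finite) auto
  also have "\<dots> \<le> (\<Sum>s\<in>{..<k}. exp (- ((\<mu> s)\<^sup>2 / (2 * (real n0 * (a * u s))))))"
  proof (intro sum_mono)
    fix s assume "s \<in> {..<k}"
    hence s: "s \<le> k" by simp
    have "real n0 * F (u s) \<le> real n0 * (a * u s)" "0 < real n0 * (a * u s)"
      using Fu[OF s] n by auto
    thus "prob {\<omega>\<in>space M. real (hits (low (u s)) 0 n0 \<omega>) \<le> real n0 * F (u s) - \<mu> s}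
        \<le> exp (- ((\<mu> s)\<^sup>2 / (2 * (real n0 * (a * u s)))))"
      using hits_lower_tail[of "low (u s)" "F (u s)" n0 "real n0 * (a * u s)" "\<mu> s" 0]
        u(1)[OF s] F_eq[of "u s"] dev(1)[OF s] by simp
  qed
  finally have A2: "prob A2 \<le> \<dots>" .
  have "prob A3 \<le> (\<Sum>s\<in>{1..k}. prob (\<Union>n\<in>{n0..n1}.
     {\<omega>\<in>space M. real (hits (low (u s)) n0 n \<omega>) \<le> real (n - n0) * F (u s) - \<xi> s}))"
    unfolding A3_def by (rule finite_measure_subadditive_finite) (auto intro!: sets.finite_UN)
  also have "\<dots> \<le> (\<Sum>s\<in>{1..k}. \<Sum>n\<in>{n0..n1}. prob
     {\<omega>\<in>space M. real (hits (low (u s)) n0 n \<omega>) \<le> real (n - n0) * F (u s) - \<xi> s})"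
    by (intro sum_mono finite_measure_subadditive_finite) auto
  also have "\<dots> \<le> (\<Sum>s\<in>{1..k}. \<Sum>n\<in>{n0..n1}. exp (- ((\<xi> s)\<^sup>2 / (2 * (g * (a * u s))))))"
  proof (intro sum_mono)
    fix s n' assume sn: "s \<in> {1..k}" "n' \<in> {n0..n1}"
    hence s: "s \<le> k" by simp
    have "real (n' - n0) \<le> g" using sn n(3) by (auto simp: of_nat_diff)
    hence "real (n' - n0) * F (u s) \<le> g * (a * u s)" "0 < g * (a * u s)"
      using Fu[OF s] n F_pos[OF u(1)[OF s]] by (auto intro!: mult_mono)
    thus "prob {\<omega>\<in>space M. real (hits (low (u s)) n0 n' \<omega>) \<le> real (n' - n0) * F (u s) - \<xi> s}
        \<le> exp (- ((\<xi> s)\<^sup>2 / (2 * (g * (a * u s)))))"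
      using hits_lower_tail[of "low (u s)" "F (u s)" "n' - n0" "g * (a * u s)" "\<xi> s" n0]
        u(1)[OF s] F_eq[of "u s"] dev(2)[OF s] sn by simp
  qed
  also have "\<dots> = (\<Sum>s\<in>{1..k}. real (n1 - n0 + 1) * exp (- ((\<xi> s)\<^sup>2 / (2 * (g * (a * u s))))))"
    using n by (simp add: Suc_diff_le)
  finally have A3: "prob A3 \<le> \<dots>" .
  have "prob (A1 \<union> A2 \<union> A3) \<le> prob A1 + prob A2 + prob A3"
    using measure_Un_le[of "A1 \<union> A2" M A3] measure_Un_le[of A1 M A2] by simp
  moreover have "\<exists>s\<in>{1..k}. real n' * (a * u s) \<le> hits (low (u s)) 0 n' \<omega>"
    if \<omega>: "\<omega> \<in> space M - (A1 \<union> A2 \<union> A3)" and n': "n' \<in> {n0..n1}" for \<omega> n'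
  proof -
    obtain s where s: "s \<in> {1..k}" "real n0 * q s + sqrt (real n0 * q s) / 20 \<le> real (hits (E s) 0 n0 \<omega>)"
      using \<omega> by (auto simp: A1_def not_less)
    have 2: "real n0 * F (u (s - 1)) - \<mu> (s - 1) \<le> real (hits (low (u (s - 1))) 0 n0 \<omega>)"
    proof -
      have "s - 1 \<in> {..<k}" using s(1) by auto
      moreover have "\<omega> \<in> space M" "\<omega> \<notin> A2" using \<omega> by auto
      ultimately show ?thesis unfolding A2_def by force
    qed
    have 3: "real (n' - n0) * F (u s) - \<xi> s \<le> real (hits (low (u s)) n0 n' \<omega>)"
    proof -
      have "\<omega> \<in> space M" "\<omega> \<notin> A3" using \<omega> by auto
      thus ?thesis using s(1) n' unfolding A3_def by force
    qed
    have "u (s - 1) \<le> u s" using s by (intro u) auto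
    hence "low (u s) = low (u (s - 1)) \<union> E s" by (auto simp: E_def low_def)
    hence "hits (low (u s)) 0 n0 \<omega> = hits (low (u (s - 1))) 0 n0 \<omega> + hits (E s) 0 n0 \<omega>"
      using hits_Un[of "low (u (s - 1))" "E s"] by (simp add: E_def)
    hence "real (hits (low (u s)) 0 n' \<omega>) = real (hits (low (u (s - 1))) 0 n0 \<omega>) + real (hits (E s) 0 n0 \<omega>)
       + real (hits (low (u s)) n0 n' \<omega>)"
      using hits_split[of 0 n0 n' "low (u s)" \<omega>] n' by simp
    moreover have "real n' * (a * u s - F (u s)) \<le> real n1 * (a * u s - F (u s))"
      using n' Fu[of s] s by (intro mult_right_mono) auto
    moreover have "real (n' - n0) = real n' - real n0" using n' by auto
    ultimately have "real n' * (a * u s) \<le> real (hits (low (u s)) 0 n' \<omega>)"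
      using 2 3 s(2) slack[OF s(1)] by (simp add: q_def algebra_simps)
    thus ?thesis using s(1) by blast
  qed
  ultimately show ?thesis using A1 A2 A3
    by (intro bexI[of _ "A1 \<union> A2 \<union> A3"] conjI) (auto intro: order_trans)
qed

text \<open>The \<open>i\<close>-th block starts at \<open>exp (i\<^sup>1\<^sup>/\<^sup>4)\<close>. Its relative length is then about \<open>T\<^sup>-\<^sup>3\<close> for \<open>T = i\<^sup>1\<^sup>/\<^sup>4\<close>, the
  logarithm of the sample size, and quantities such as \<open>exp (- \<surd>T / 80)\<close> are summable over \<open>i\<close>.\<close>

definition logsize :: "nat \<Rightarrow> real" where "logsize i = real i powr (1 / 4)"

definition block :: "nat \<Rightarrow> nat" where "block i = nat \<lceil>exp (logsize i)\<rceil>"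

lemma block_ge: "exp (logsize i) \<le> real (block i)"
  unfolding block_def by linarith

lemma block_le: "real (block i) \<le> exp (logsize i) + 1"
  unfolding block_def using exp_gt_zero[of "logsize i"] by linarith

lemma block_mono: "i \<le> j \<Longrightarrow> block i \<le> block j"
  unfolding block_def logsize_def by (intro nat_mono ceiling_mono) (simp add: powr_mono2)

lemma ex_block:
  assumes "block i0 \<le> n"
  shows "\<exists>i\<ge>i0. block i \<le> n \<and> n \<le> block (Suc i)"
proof -
  have "filterlim (\<lambda>i. exp (logsize i)) at_top sequentially" unfolding logsize_def by real_asymp
  hence "\<forall>\<^sub>F i in sequentially. real n < exp (logsize i)" by (simp add: filterlim_at_top_dense)
  then obtain N where "real n < exp (logsize N)" by (auto simp: eventually_sequentially)
  hence N: "n < block N" using block_ge[of N] by linarith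
  define S where "S = {i. block i \<le> n}"
  have "S \<subseteq> {..<N}" using N block_mono by (force simp: S_def not_le[symmetric])
  hence fin: "finite S" using finite_subset by blast
  have i0: "i0 \<in> S" using assms by (simp add: S_def)
  hence "Max S \<in> S" using fin by (intro Max_in) auto
  moreover have "Suc (Max S) \<notin> S" using Max_ge[OF fin, of "Suc (Max S)"] by (auto simp del: Max_ge)
  ultimately show ?thesis using Max_ge[OF fin i0] by (auto simp: S_def)
qed

lemma block_gap:
  "\<forall>\<^sub>F i in sequentially. real (block (Suc i)) - real (block i) \<le> real (block i) / logsize i ^ 3"
proof -
  have "\<forall>\<^sub>F i in sequentially. exp (logsize (Suc i)) + 1 - exp (logsize i) \<le> exp (logsize i) / logsize i ^ 3"
    unfolding logsize_def by real_asymp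
  moreover have "\<forall>\<^sub>F i in sequentially. 0 < logsize i" unfolding logsize_def by real_asymp
  ultimately show ?thesis
  proof eventually_elim
    case (elim i)
    have "exp (logsize i) / logsize i ^ 3 \<le> real (block i) / logsize i ^ 3"
      using elim by (intro divide_right_mono block_ge) auto
    thus ?case using elim block_le[of "Suc i"] block_ge[of i] by linarith
  qed
qed

text \<open>With \<open>T\<close> the logarithm of the sample size, take \<open>k = \<lfloor>\<surd>T\<rfloor>\<close> scales \<open>u s = exp (- T (1 - \<nu> + \<epsilon>)) (T\<^sup>2)\<^sup>s\<close>. All of
  them stay below \<open>U = exp (- T (1 - \<nu> + \<epsilon>/2))\<close>, where the gap is negligible, and reaching the tangent at any of
  them gives \<open>R\<^sub>n \<ge> n a (u 0)\<close>, that is at least \<open>n\<^sup>\<nu>\<^sup>-\<^sup>\<epsilon>\<close>. With \<open>r = sqrt (n0 a (u s))\<close>, both allowed deviations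
  \<open>\<mu> (s - 1)\<close> and \<open>\<xi> s\<close> equal \<open>r / \<surd>T\<close>: the first because consecutive scales differ by the factor \<open>T\<^sup>2\<close>, the second
  by choice. They fail with probabilities \<open>exp (- T/2)\<close> and \<open>exp (- T\<^sup>2/2)\<close>; the latter absorbs the union over
  the at most \<open>3 exp T\<close> sample sizes of the block.\<close>

lemma eventually_block_lower_bound:
  assumes \<epsilon>: "0 < \<epsilon>" "\<epsilon> < nu"
  shows "\<forall>\<^sub>F i in sequentially. \<exists>A\<in>events.
    (\<forall>\<omega>\<in>space M - A. \<forall>n\<in>{block i..block (Suc i)}. real n powr (nu - \<epsilon>) \<le> real (R n \<omega>)) \<and>
    prob A \<le> exp (- (sqrt (logsize i) - 1) / 80) + logsize i * exp (- logsize i / 2)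
      + logsize i * (3 * exp (logsize i)) * exp (- (logsize i)\<^sup>2 / 2)"
proof -
  define w where "w = 1 - nu"
  have w: "0 < w" "w < 1" using nu_bounds by (auto simp: w_def)
  have a0: "a > 0" using a_gt_1 by simp
  obtain d where d: "d > 0" "\<And>u. u \<in> {0..1} \<Longrightarrow> u < d \<Longrightarrow> \<bar>a * u - F u - c * u ^ l\<bar> \<le> c * u ^ l"
    using F_expansion[OF c_pos] by auto
  \<comment> \<open>Constants for the smallness of \<open>U\<close>: \<open>F u \<ge> 3/4 a u\<close> and \<open>a u \<le> 1/2\<close> for \<open>u \<le> U\<close>.\<close>
  define d' where "d' = min d (min (1 / (2 * a)) (a / (8 * c)))"
  have d': "d' > 0" using d(1) a0 c_pos by (simp add: d'_def)
  \<comment> \<open>Bound on \<open>n0 (u s)\<^sup>2\<^sup>l\<^sup>-\<^sup>1\<close> that makes the contribution of the gap at most \<open>r / 100\<close>.\<close>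
  define d'' where "d'' = a / (160000 * c\<^sup>2)"
  have d'': "d'' > 0" using a0 c_pos by (simp add: d''_def)
  define T where "T = logsize"
  have Tinf: "filterlim T at_top sequentially" unfolding T_def logsize_def by real_asymp
  have ev1: "\<forall>\<^sub>F i in sequentially. 2 * sqrt (T i) * ln (T i) \<le> T i * (\<epsilon> / 2)"
    unfolding T_def logsize_def using \<epsilon> by real_asymp
  have "((\<lambda>t. exp (- t * (w + \<epsilon> / 2))) \<longlongrightarrow> 0) at_top" using w \<epsilon> by real_asymp
  hence "\<forall>\<^sub>F i in sequentially. exp (- T i * (w + \<epsilon> / 2)) < d'"
    using order_tendstoD(2)[OF filterlim_compose[OF _ Tinf] d'] by blast
  moreover have "((\<lambda>t. 2 * exp (- t * \<epsilon>)) \<longlongrightarrow> 0) at_top" using \<epsilon> by real_asymp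
  hence "\<forall>\<^sub>F i in sequentially. 2 * exp (- T i * \<epsilon>) < d''"
    using order_tendstoD(2)[OF filterlim_compose[OF _ Tinf] d''] by blast
  moreover have "filterlim (\<lambda>t. exp (t * (nu - \<epsilon>))) at_top at_top" using \<epsilon> by real_asymp
  hence "filterlim (\<lambda>i. exp (T i * (nu - \<epsilon>))) at_top sequentially"
    using filterlim_compose Tinf by blast
  hence "\<forall>\<^sub>F i in sequentially. 2 \<le> exp (T i * (nu - \<epsilon>))" by (simp add: filterlim_at_top)
  moreover have "\<forall>\<^sub>F i in sequentially. 40000 \<le> T i" using Tinf by (simp add: filterlim_at_top)
  ultimately show ?thesis using block_gap ev1
  proof eventually_elim
    case (elim i)
    define t where "t = T i"
    define n0 n1 k where "n0 = block i" and "n1 = block (Suc i)" and "k = nat \<lfloor>sqrt t\<rfloor>"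
    define u where "u = (\<lambda>s. exp (- t * (w + \<epsilon>)) * (t\<^sup>2) ^ s)"
    define U where "U = exp (- t * (w + \<epsilon> / 2))"
    have t: "40000 \<le> t" "t > 0" "1 \<le> t" using elim by (auto simp: t_def)
    have U: "U < d" "U < 1 / (2 * a)" "U < a / (8 * c)" using elim by (auto simp: U_def t_def d'_def)
    have "1 / (2 * a) \<le> 1" using a_gt_1 by simp
    hence U1: "U \<le> 1" using U(2) by linarith
    have n0: "exp t \<le> real n0" "real n0 \<le> 2 * exp t"
      using block_ge[of i] block_le[of i] one_le_exp_iff[of t] t unfolding n0_def t_def T_def by linarith+
    have n0p: "real n0 > 0" using n0(1) exp_gt_zero[of t] by linarith
    have n01: "n0 \<le> n1" unfolding n0_def n1_def by (rule block_mono) simp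
    have gap: "real (n1 - n0) \<le> real n0 / t ^ 3"
      using elim n01 by (simp add: n0_def n1_def t_def T_def of_nat_diff)
    have "real n0 / t ^ 3 \<le> real n0 / 1" using t by (intro divide_left_mono) auto
    hence gap': "real (n1 - n0) \<le> real n0" using gap by simp
    hence n1: "real n1 \<le> 2 * real n0" using n01 by (simp add: of_nat_diff)
    have k: "real k \<le> sqrt t" "sqrt t - 1 \<le> real k" unfolding k_def using t by (auto simp: of_nat_floor)
    have "sqrt t \<le> t" using t by (simp add: real_le_lsqrt power2_eq_square)
    hence kt: "real k \<le> t" using k by simp
    have uk: "u s \<le> U" if "s \<le> k" for s
    proof -
      have "(t\<^sup>2) ^ s = exp (real s * (2 * ln t))"
      proof -
        have "t\<^sup>2 = exp (2 * ln t)" using t by (simp add: exp_double)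
        thus ?thesis by (simp only: exp_of_nat_mult)
      qed
      also have "\<dots> \<le> exp (sqrt t * (2 * ln t))"
      proof -
        have "real s \<le> sqrt t" using that k(1) by linarith
        thus ?thesis using t by (simp add: mult_right_mono)
      qed
      also have "\<dots> \<le> exp (t * (\<epsilon> / 2))" using elim by (simp add: t_def mult_ac)
      finally have "u s \<le> exp (- t * (w + \<epsilon>)) * exp (t * (\<epsilon> / 2))" unfolding u_def by simp
      also have "\<dots> = exp (- t * (w + \<epsilon>) + t * (\<epsilon> / 2))" by (simp only: exp_add)
      also have "- t * (w + \<epsilon>) + t * (\<epsilon> / 2) = - t * (w + \<epsilon> / 2)" by (simp add: field_simps)
      finally show ?thesis unfolding U_def .
    qed
    have upos: "u s > 0" for s unfolding u_def using t by simp
    have u_mono: "u s \<le> u s'" if "s \<le> s'" for s s'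
      unfolding u_def using t that by (intro mult_left_mono power_increasing) (auto simp: one_le_power)
    have uS: "u s = t\<^sup>2 * u (s - 1)" if "s \<ge> 1" for s
      unfolding u_def using that by (cases s) auto
    have Fu_le: "F (u s) \<le> a * u s" if "s \<le> k" for s
      using F_below[of "u s"] upos[of s] uk[OF that] U1 by auto
    have Fu_gap: "a * u s - F (u s) \<le> 2 * c * u s ^ l" if "s \<le> k" for s
      using abs_le_D1[OF d(2)[of "u s"]] upos[of s] uk[OF that] U1 U(1) by auto
    have Fu_ge: "3 / 4 * (a * u s) \<le> F (u s)" if "s \<le> k" for s
    proof -
      have us: "0 < u s" "u s \<le> U" "u s \<le> 1" using upos uk[OF that] U1 by auto
      have "u s ^ l \<le> u s ^ 2" using us l_ge_2 by (intro power_decreasing) auto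
      hence "2 * c * u s ^ l \<le> 2 * c * u s * u s" using c_pos by (simp add: power2_eq_square)
      also have "\<dots> \<le> a / 4 * u s"
      proof (rule mult_right_mono)
        have "2 * c * u s \<le> 2 * c * (a / (8 * c))" using us U(3) c_pos by (intro mult_left_mono) auto
        thus "2 * c * u s \<le> a / 4" using c_pos by simp
      qed (use us in auto)
      finally show ?thesis using Fu_gap[OF that] by simp
    qed
    define q where "q = (\<lambda>s. F (u s) - F (u (s - 1)))"
    have q: "a * u s / 2 \<le> q s" "q s \<le> 1 / 2" if s: "s \<in> {1..k}" for s
    proof -
      have sk: "s \<le> k" "s - 1 \<le> k" "1 \<le> s" using s by auto
      \<comment> \<open>The scales are so far apart that the mass below \<open>u (s - 1)\<close> is a small part of \<open>F (u s)\<close>.\<close>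
      have "4 * u (s - 1) \<le> t\<^sup>2 * u (s - 1)"
      proof (rule mult_right_mono)
        have "2 ^ 2 \<le> t\<^sup>2" using t by (intro power_mono) auto
        thus "4 \<le> t\<^sup>2" by simp
      qed (use upos[of "s - 1"] in simp)
      hence "u (s - 1) \<le> u s / 4" using uS[OF sk(3)] by simp
      hence "a * u (s - 1) \<le> a * (u s / 4)" using a0 by (intro mult_left_mono) auto
      hence "F (u (s - 1)) \<le> a * u s / 4" using Fu_le[OF sk(2)] by simp
      thus "a * u s / 2 \<le> q s" using Fu_ge[OF sk(1)] unfolding q_def by simp
      have "0 < F (u (s - 1))" using upos[of "s - 1"] uk[OF sk(2)] U1 by (intro F_pos) auto
      hence "q s \<le> a * u s" using Fu_le[OF sk(1)] unfolding q_def by linarith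
      also have "\<dots> \<le> a * (1 / (2 * a))" using uk[OF sk(1)] U(2) a0 by (intro mult_left_mono) auto
      finally show "q s \<le> 1 / 2" using a0 by simp
    qed
    have nq: "1 \<le> real n0 * q s" if s: "s \<in> {1..k}" for s
    proof -
      have "1 \<le> exp (t * (nu - \<epsilon>)) / 2" using elim by (simp add: t_def)
      also have "\<dots> = exp t * (u 0 / 2)" by (simp add: u_def w_def algebra_simps flip: exp_add)
      also have "\<dots> \<le> real n0 * (a * u s / 2)"
      proof -
        have "1 * u 0 \<le> a * u s" using a_gt_1 u_mono[of 0 s] upos[of 0] by (intro mult_mono) auto
        thus ?thesis using n0 upos[of 0] by (intro mult_mono) auto
      qed
      also have "\<dots> \<le> real n0 * q s" using q[OF s] by (intro mult_left_mono) auto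
      finally show ?thesis .
    qed
    define \<mu> where "\<mu> = (\<lambda>s. sqrt (real n0 * (a * u s) * t))"
    define \<xi> where "\<xi> = (\<lambda>s. sqrt (real n0 * (a * u s) / t))"
    have slack: "real n1 * (a * u s - F (u s)) + \<mu> (s - 1) + \<xi> s \<le> sqrt (real n0 * q s) / 20"
      if s: "s \<in> {1..k}" for s
    proof -
      define r where "r = sqrt (real n0 * (a * u s))"
      have r: "r > 0" unfolding r_def using n0p a0 upos by simp
      have sk: "s \<le> k" "1 \<le> s" using s by auto
      have "\<mu> (s - 1) = \<xi> s" unfolding \<mu>_def \<xi>_def uS[OF sk(2)] using t
        by (simp add: power2_eq_square)
      moreover have "\<xi> s = r / sqrt t" by (simp add: \<xi>_def r_def real_sqrt_divide)
      moreover have "r / sqrt t \<le> r / 200"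
      proof (rule divide_left_mono)
        have "sqrt (200\<^sup>2) \<le> sqrt t" using t by (intro real_sqrt_le_mono) auto
        thus "200 \<le> sqrt t" by simp
      qed (use r t in auto)
      moreover have "real n1 * (a * u s - F (u s)) \<le> r / 100"
      proof -
        have "real n1 * (a * u s - F (u s)) \<le> (2 * real n0) * (2 * c * u s ^ l)"
          using n1 Fu_gap[OF sk(1)] Fu_le[OF sk(1)] n0p by (intro mult_mono) auto
        also have "\<dots> \<le> r / 100"
        proof -
          have "real n0 * u s ^ (2 * l - 1) \<le> d''"
          proof -
            have "u s ^ (2 * l - 1) \<le> U ^ (2 * l - 1)"
              using uk[OF sk(1)] upos[of s] by (intro power_mono) auto
            hence "real n0 * u s ^ (2 * l - 1) \<le> (2 * exp t) * U ^ (2 * l - 1)"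
              using n0 upos[of s] by (intro mult_mono) auto
            also have "\<dots> = 2 * exp (t - t * (w + \<epsilon> / 2) * real (2 * l - 1))"
              unfolding U_def by (simp add: mult_ac flip: exp_of_nat_mult exp_add)
            also have "t - t * (w + \<epsilon> / 2) * real (2 * l - 1) = - (t * (\<epsilon> / 2) * real (2 * l - 1))"
            proof -
              have w1: "w * real (2 * l - 1) = 1"
                unfolding w_def real_2l one_minus_nu using l_ge_2 by simp
              have split: "t - t * (w + \<epsilon> / 2) * m = t * (1 - w * m) - t * (\<epsilon> / 2) * m" for m
                by (simp add: algebra_simps)
              show ?thesis unfolding split w1 by simp
            qed
            also have "\<dots> \<le> - (t * (\<epsilon> / 2) * 2)"
              using l_ge_2 t \<epsilon> real_2l by (intro le_imp_neg_le mult_left_mono) auto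
            finally have "real n0 * u s ^ (2 * l - 1) \<le> 2 * exp (- t * \<epsilon>)" by simp
            thus ?thesis using elim by (simp add: t_def)
          qed
          hence "160000 * c\<^sup>2 * (real n0 * u s ^ (2 * l - 1)) \<le> a"
            using c_pos by (simp add: d''_def field_simps)
          hence "160000 * c\<^sup>2 * (real n0 * u s ^ (2 * l - 1)) * (real n0 * u s) \<le> a * (real n0 * u s)"
            using n0p upos[of s] by (intro mult_right_mono) auto
          also have "160000 * c\<^sup>2 * (real n0 * u s ^ (2 * l - 1)) * (real n0 * u s)
              = 160000 * c\<^sup>2 * (real n0)\<^sup>2 * (u s ^ (2 * l - 1) * u s)"
            by (simp add: power2_eq_square mult_ac)
          also have "u s ^ (2 * l - 1) * u s = (u s ^ l)\<^sup>2"
          proof -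
            have "u s ^ (2 * l - 1) * u s = u s ^ Suc (2 * l - 1)" by simp
            also have "Suc (2 * l - 1) = 2 * l" using l_ge_2 by simp
            finally show ?thesis by (simp add: power_even_eq)
          qed
          finally have "(400 * real n0 * c * u s ^ l)\<^sup>2 \<le> real n0 * (a * u s)"
            by (simp add: power_mult_distrib mult_ac)
          hence "400 * real n0 * c * u s ^ l \<le> r" unfolding r_def by (rule real_le_rsqrt)
          thus ?thesis by simp
        qed
        finally show ?thesis .
      qed
      moreover have "r / 50 \<le> sqrt (real n0 * q s) / 20"
      proof -
        have "(2 / 5 * r)\<^sup>2 \<le> real n0 * q s"
        proof -
          have "(2 / 5 * r)\<^sup>2 = 4 / 25 * (real n0 * (a * u s))"
            unfolding r_def using n0p a0 upos[of s] by (simp add: power_mult_distrib power2_eq_square)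
          also have "\<dots> \<le> real n0 * (a * u s / 2)" using n0p a0 upos[of s] by simp
          also have "\<dots> \<le> real n0 * q s" using q[OF s] by (intro mult_left_mono) auto
          finally show ?thesis .
        qed
        hence "2 / 5 * r \<le> sqrt (real n0 * q s)" by (rule real_le_rsqrt)
        thus ?thesis by simp
      qed
      ultimately show ?thesis by linarith
    qed
    have fail: "\<exists>A\<in>events. (\<forall>\<omega>\<in>space M - A. \<forall>n\<in>{n0..n1}. \<exists>s\<in>{1..k}. real n * (a * u s) \<le> hits (low (u s)) 0 n \<omega>) \<and>
      prob A \<le> (79 / 80) ^ k + (\<Sum>s\<in>{..<k}. exp (- ((\<mu> s)\<^sup>2 / (2 * (real n0 * (a * u s))))))
      + (\<Sum>s\<in>{1..k}. real (n1 - n0 + 1) * exp (- ((\<xi> s)\<^sup>2 / (2 * (real n0 / t ^ 3 * (a * u s))))))"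
    proof (rule block_failure)
      show "u s \<in> {0<..1}" if "s \<le> k" for s using uk[OF that] U1 upos[of s] by auto
      show "0 \<le> \<mu> s" "0 \<le> \<xi> s" for s unfolding \<mu>_def \<xi>_def using n0p a0 upos[of s] t by auto
    qed (use n0p n01 gap t u_mono q nq slack in \<open>auto simp: q_def\<close>)
    have \<mu>_exponent: "(\<mu> s)\<^sup>2 / (2 * (real n0 * (a * u s))) = t / 2" for s
      unfolding \<mu>_def using n0p a0 upos[of s] t by simp
    have \<xi>_exponent: "(\<xi> s)\<^sup>2 / (2 * (real n0 / t ^ 3 * (a * u s))) = t\<^sup>2 / 2" for s
      unfolding \<xi>_def using n0p a0 upos[of s] t by (simp add: field_simps power2_eq_square power3_eq_cube)
    obtain A where A: "A \<in> events"
      "\<And>\<omega> n. \<omega> \<in> space M - A \<Longrightarrow> n \<in> {n0..n1} \<Longrightarrow> \<exists>s\<in>{1..k}. real n * (a * u s) \<le> hits (low (u s)) 0 n \<omega>"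
      and pA: "prob A \<le> (79 / 80) ^ k + real k * exp (- (t / 2)) + real k * (real (n1 - n0 + 1) * exp (- (t\<^sup>2 / 2)))"
      using fail unfolding \<mu>_exponent \<xi>_exponent by auto
    note pA
    also have "(79 / 80) ^ k + real k * exp (- (t / 2)) + real k * (real (n1 - n0 + 1) * exp (- (t\<^sup>2 / 2)))
      \<le> exp (- (sqrt t - 1) / 80) + t * exp (- (t / 2)) + t * (3 * exp t * exp (- (t\<^sup>2 / 2)))"
    proof (intro add_mono mult_mono)
      have "(79 / 80 :: real) \<le> exp (- 1 / 80)" using exp_ge_add_one_self[of "- 1 / 80 :: real"] by simp
      hence "(79 / 80 :: real) ^ k \<le> exp (- 1 / 80) ^ k" by (intro power_mono) auto
      also have "\<dots> = exp (- real k / 80)" by (simp flip: exp_of_nat_mult)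
      also have "\<dots> \<le> exp (- (sqrt t - 1) / 80)" using k(2) by simp
      finally show "(79 / 80 :: real) ^ k \<le> exp (- (sqrt t - 1) / 80)" .
      have "real (n1 - n0 + 1) \<le> real n0 + 1" using gap' by simp
      also have "\<dots> \<le> 3 * exp t" using n0 t one_le_exp_iff[of t] by linarith
      finally show "real (n1 - n0 + 1) \<le> 3 * exp t" .
    qed (use kt t in auto)
    finally have pA': "prob A \<le> exp (- (sqrt t - 1) / 80) + t * exp (- t / 2) + t * (3 * exp t) * exp (- t\<^sup>2 / 2)"
      by (simp add: mult.assoc)
    have "real n powr (nu - \<epsilon>) \<le> real (R n \<omega>)" if \<omega>: "\<omega> \<in> space M - A" and n: "n \<in> {n0..n1}" for \<omega> n
    proof -
      obtain s where s: "s \<in> {1..k}" "real n * (a * u s) \<le> hits (low (u s)) 0 n \<omega>" using A(2)[OF \<omega> n] by auto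
      have np: "real n > 0" "exp t \<le> real n" using n n0p n0 by auto
      have hR: "hits (low (u s)) 0 n \<omega> \<le> R n \<omega>"
        unfolding hits_low
      proof (rule num_le_le_BH_R)
        show "real n * u s \<le> 1 / a * real (num_le (\<lambda>j. p j \<omega>) n (u s))"
          using s(2) a0 unfolding hits_low by (simp add: field_simps)
      qed (use a0 np in auto)
      have "t \<le> ln (real n)" using np ln_ge_iff[of "real n" t] by simp
      hence "t * (w + \<epsilon>) \<le> ln (real n) * (w + \<epsilon>)" using w \<epsilon> by (intro mult_right_mono) auto
      hence "exp (- ln (real n) * (w + \<epsilon>)) \<le> u 0" unfolding u_def by simp
      also have "\<dots> \<le> 1 * u s" using u_mono[of 0 s] by simp
      also have "\<dots> \<le> a * u s" using a_gt_1 upos[of s] by (intro mult_right_mono) auto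
      finally have "real n * exp (- ln (real n) * (w + \<epsilon>)) \<le> real n * (a * u s)"
        using np by (intro mult_left_mono) auto
      moreover have "real n powr (nu - \<epsilon>) = real n * exp (- ln (real n) * (w + \<epsilon>))"
      proof -
        have "nu - \<epsilon> = 1 + - (w + \<epsilon>)" by (simp add: w_def)
        hence "real n powr (nu - \<epsilon>) = real n powr 1 * real n powr (- (w + \<epsilon>))" by (simp only: powr_add)
        thus ?thesis using np by (simp add: powr_def algebra_simps)
      qed
      ultimately have "real n powr (nu - \<epsilon>) \<le> real n * (a * u s)" by linarith
      also have "\<dots> \<le> real (R n \<omega>)" using s(2) hR by linarith
      finally show ?thesis .
    qed
    thus ?case using A(1) pA' unfolding n0_def n1_def t_def T_def by blast
  qed
qed

lemma lower_bound_AE: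
  assumes \<epsilon>: "0 < \<epsilon>" "\<epsilon> < nu"
  shows "AE \<omega> in M. \<forall>\<^sub>F n in sequentially. real n powr (nu - \<epsilon>) \<le> real (R n \<omega>)"
proof -
  define b where "b = (\<lambda>i. exp (- (sqrt (logsize i) - 1) / 80) + logsize i * exp (- logsize i / 2)
      + logsize i * (3 * exp (logsize i)) * exp (- (logsize i)\<^sup>2 / 2))"
  define good where "good = (\<lambda>i \<omega>. \<forall>n\<in>{block i..block (Suc i)}. real n powr (nu - \<epsilon>) \<le> real (R n \<omega>))"
  define Q where "Q = (\<lambda>i A. A \<in> events \<and> (\<forall>\<omega>\<in>space M - A. good i \<omega>) \<and> prob A \<le> b i)"
  define A where "A = (\<lambda>i. if \<exists>A. Q i A then SOME A. Q i A else {})"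
  have "\<forall>\<^sub>F i in sequentially. \<exists>A. Q i A"
    using eventually_block_lower_bound[OF \<epsilon>] unfolding Q_def good_def b_def
    by (rule eventually_mono) blast
  hence Q: "\<forall>\<^sub>F i in sequentially. Q i (A i)"
    by (rule eventually_mono) (unfold A_def, simp, erule someI_ex)
  have "A i \<in> events" for i
  proof (cases "\<exists>A. Q i A")
    case True
    hence "Q i (A i)" using someI_ex[OF True] by (simp add: A_def)
    thus ?thesis unfolding Q_def by blast
  next
    case False
    hence "A i = {}" unfolding A_def by (rule if_not_P)
    thus ?thesis by simp
  qed
  moreover have "\<forall>\<^sub>F i in sequentially. prob (A i) \<le> b i"
    using Q by (rule eventually_mono) (simp add: Q_def)
  moreover have "summable b"
  proof (rule summable_comparison_test_ev)
    have Tinf: "filterlim logsize at_top sequentially" unfolding logsize_def by real_asymp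
    have "\<forall>\<^sub>F t in at_top. exp (- (sqrt t - 1) / 80) \<le> t powr - (8::real)"
      by real_asymp
    from eventually_compose_filterlim[OF this Tinf]
    have "\<forall>\<^sub>F i in sequentially. exp (- (sqrt (logsize i) - 1) / 80) \<le> logsize i powr - 8" .
    moreover have "\<forall>\<^sub>F t in at_top. t * exp (- t / 2) \<le> t powr - (8::real)"
      by real_asymp
    from eventually_compose_filterlim[OF this Tinf]
    have "\<forall>\<^sub>F i in sequentially. logsize i * exp (- logsize i / 2) \<le> logsize i powr - 8" .
    moreover have "\<forall>\<^sub>F t in at_top. t * (3 * exp t) * exp (- t\<^sup>2 / 2) \<le> t powr - (8::real)"
      by real_asymp
    from eventually_compose_filterlim[OF this Tinf]
    have "\<forall>\<^sub>F i in sequentially. logsize i * (3 * exp (logsize i)) * exp (- (logsize i)\<^sup>2 / 2) \<le> logsize i powr - 8" .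
    ultimately show "\<forall>\<^sub>F i in sequentially. norm (b i) \<le> 3 * real i powr - 2"
    proof eventually_elim
      case (elim i)
      have "0 \<le> b i" unfolding b_def logsize_def by (intro add_nonneg_nonneg mult_nonneg_nonneg) auto
      thus ?case using elim by (simp add: b_def logsize_def powr_powr)
    qed
    show "summable (\<lambda>i. 3 * real i powr - 2)"
      by (intro summable_mult) (simp add: summable_real_powr_iff)
  qed
  ultimately have "AE \<omega> in M. \<forall>\<^sub>F i in sequentially. \<omega> \<notin> A i"
    by (rule AE_eventually_not_in)
  thus ?thesis
  proof (rule AE_mp, intro AE_I2 impI)
    fix \<omega> assume \<omega>: "\<omega> \<in> space M" and ev: "\<forall>\<^sub>F i in sequentially. \<omega> \<notin> A i"
    have "\<forall>\<^sub>F i in sequentially. good i \<omega>"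
      using ev Q by eventually_elim (use \<omega> in \<open>auto simp: Q_def\<close>)
    then obtain i0 where i0: "\<And>i. i \<ge> i0 \<Longrightarrow> good i \<omega>" by (auto simp: eventually_sequentially)
    have "real n powr (nu - \<epsilon>) \<le> real (R n \<omega>)" if "block i0 \<le> n" for n
      using ex_block[OF that] i0 by (auto simp: good_def)
    thus "\<forall>\<^sub>F n in sequentially. real n powr (nu - \<epsilon>) \<le> real (R n \<omega>)"
      by (auto simp: eventually_sequentially)
  qed
qed

end

section \<open>False discoveries and limits\<close>

context critical_BH
begin

text \<open>Uniformity over all ranks \<open>k \<ge> \<surd>n\<close> matters since the law of large numbers will be used at the random rank
  \<open>R\<^sub>n\<close>. It costs a factor \<open>n\<close> against tails \<open>exp (- h \<surd>n)\<close>.\<close>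

lemma null_hits_AE:
  assumes \<delta>: "0 < \<delta>"
  defines "\<beta> \<equiv> (1 - \<pi>) / a"
  shows "AE \<omega> in M. \<forall>\<^sub>F n in sequentially. \<forall>k\<in>{1..n}. sqrt (real n) \<le> real k \<longrightarrow>
    \<bar>real (hits (null_low (real k / (a * real n))) 0 n \<omega>) - \<beta> * real k\<bar> \<le> \<delta> * (\<beta> * real k)"
proof -
  have \<beta>: "\<beta> > 0" using pi_range a_gt_1 by (simp add: \<beta>_def)
  define h where "h = \<beta> * (\<delta>\<^sup>2 / (2 * (1 + \<delta>)))"
  have h: "h > 0" using \<beta> \<delta> by (simp add: h_def)
  define H where "H = (\<lambda>n k \<omega>. real (hits (null_low (real k / (a * real n))) 0 n \<omega>))"
  define K where "K = (\<lambda>n. {k\<in>{1..n}. sqrt (real n) \<le> real k})"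
  define Up where "Up = (\<lambda>n k. {\<omega>\<in>space M. \<beta> * real k * (1 + \<delta>) \<le> H n k \<omega>})"
  define Lo where "Lo = (\<lambda>n k. {\<omega>\<in>space M. H n k \<omega> \<le> \<beta> * real k - \<delta> * (\<beta> * real k)})"
  define A where "A = (\<lambda>n. \<Union>k\<in>K n. Up n k \<union> Lo n k)"
  have finK: "finite (K n)" for n unfolding K_def by auto
  have ev [measurable]: "Up n k \<in> events" "Lo n k \<in> events" for n k
    unfolding Up_def Lo_def H_def by measurable
  have bound: "prob (Up n k) \<le> exp (- h * sqrt (real n))" "prob (Lo n k) \<le> exp (- h * sqrt (real n))"
    if k: "k \<in> K n" for n k
  proof -
    define u where "u = real k / (a * real n)"
    have kn: "1 \<le> k" "k \<le> n" "sqrt (real n) \<le> real k" using k by (auto simp: K_def)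
    have n: "real n > 0" using kn by simp
    have "real k * 1 \<le> real n * a" using kn a_gt_1 by (intro mult_mono) auto
    hence u: "0 < u" "u \<le> 1" unfolding u_def using kn a_gt_1 n by (auto simp: field_simps)
    define q where "q = (1 - \<pi>) * u"
    have q: "q > 0" using u pi_range by (simp add: q_def)
    have qP: "q = prob {\<omega>\<in>space M. (p 0 \<omega>, \<theta> 0 \<omega>) \<in> null_low u}"
      unfolding q_def by (rule null_eq) (use u in auto)
    have nq: "real n * q = \<beta> * real k" using n a_gt_1 by (simp add: q_def u_def \<beta>_def field_simps)
    have hk: "h * sqrt (real n) \<le> h * real k" using h kn by simp
    have "prob (Up n k) \<le> exp (- (real n * (q * (1 + \<delta>) - q)\<^sup>2 / (2 * (q * (1 + \<delta>)))))"
    proof -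
      have "Up n k = {\<omega>\<in>space M. real n * (q * (1 + \<delta>)) \<le> real (hits (null_low u) 0 (0 + n) \<omega>)}"
        unfolding Up_def H_def u_def[symmetric] mult.assoc[symmetric] nq by simp
      moreover have "q \<le> q * (1 + \<delta>)" using q \<delta> by simp
      ultimately show ?thesis using hits_upper_tail[OF _ qP q, of "q * (1 + \<delta>)" n 0] by simp
    qed
    also have "real n * (q * (1 + \<delta>) - q)\<^sup>2 / (2 * (q * (1 + \<delta>))) = (real n * q) * (\<delta>\<^sup>2 / (2 * (1 + \<delta>)))"
    proof -
      define D where "D = 1 + \<delta>"
      have D: "D > 0" "q * D - q = q * \<delta>" using \<delta> by (auto simp: D_def algebra_simps)
      show ?thesis unfolding D_def[symmetric] D(2)
        using q D(1) by (simp add: field_simps power2_eq_square)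
    qed
    also have "\<dots> = h * real k" unfolding nq by (simp add: h_def)
    finally show "prob (Up n k) \<le> exp (- h * sqrt (real n))" using hk
      by (elim order_trans) simp
    have "prob (Lo n k) \<le> exp (- ((\<delta> * (\<beta> * real k))\<^sup>2 / (2 * (real n * q))))"
    proof -
      have "Lo n k = {\<omega>\<in>space M. real (hits (null_low u) 0 (0 + n) \<omega>) \<le> real n * q - \<delta> * (\<beta> * real k)}"
        unfolding Lo_def H_def u_def[symmetric] nq by simp
      thus ?thesis using hits_lower_tail[OF _ qP, of n "real n * q" "\<delta> * (\<beta> * real k)" 0] n q \<delta> \<beta> by simp
    qed
    also have "(\<delta> * (\<beta> * real k))\<^sup>2 / (2 * (real n * q)) = \<beta> * (\<delta>\<^sup>2 / 2) * real k"
      unfolding nq using \<beta> kn by (simp add: field_simps power2_eq_square)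
    also have "exp (- (\<beta> * (\<delta>\<^sup>2 / 2) * real k)) \<le> exp (- (h * real k))"
    proof -
      have "\<delta>\<^sup>2 / (2 * (1 + \<delta>)) \<le> \<delta>\<^sup>2 / 2" using \<delta> by (intro divide_left_mono) auto
      hence "\<beta> * (\<delta>\<^sup>2 / (2 * (1 + \<delta>))) * real k \<le> \<beta> * (\<delta>\<^sup>2 / 2) * real k"
        using \<beta> by (intro mult_right_mono mult_left_mono) auto
      thus ?thesis by (simp only: exp_le_cancel_iff neg_le_iff_le h_def)
    qed
    finally show "prob (Lo n k) \<le> exp (- h * sqrt (real n))" using hk
      by (elim order_trans) simp
  qed
  have "prob (A n) \<le> real n * (2 * exp (- h * sqrt (real n)))" for n
  proof -
    have "prob (A n) \<le> (\<Sum>k\<in>K n. prob (Up n k \<union> Lo n k))"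
      unfolding A_def by (rule finite_measure_subadditive_finite) (use finK in auto)
    also have "\<dots> \<le> (\<Sum>k\<in>K n. 2 * exp (- h * sqrt (real n)))"
    proof (rule sum_mono)
      fix k assume k: "k \<in> K n"
      have "prob (Up n k \<union> Lo n k) \<le> prob (Up n k) + prob (Lo n k)" by (rule measure_Un_le) auto
      thus "prob (Up n k \<union> Lo n k) \<le> 2 * exp (- h * sqrt (real n))" using bound[OF k] by linarith
    qed
    also have "\<dots> = real (card (K n)) * (2 * exp (- h * sqrt (real n)))" by simp
    also have "\<dots> \<le> real n * (2 * exp (- h * sqrt (real n)))"
    proof (rule mult_right_mono)
      have "card (K n) \<le> card {1..n}" unfolding K_def by (intro card_mono) auto
      thus "real (card (K n)) \<le> real n" by simp
    qed simp
    finally show ?thesis .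
  qed
  moreover have "summable (\<lambda>n. real n * (2 * exp (- h * sqrt (real n))))"
  proof (rule summable_comparison_test_ev)
    show "\<forall>\<^sub>F n in sequentially. norm (real n * (2 * exp (- h * sqrt (real n)))) \<le> real n powr - 2"
    proof -
      have "\<forall>\<^sub>F x in at_top. x * (2 * exp (- (h * sqrt x))) \<le> x powr - (2::real)"
        using h by real_asymp
      from eventually_compose_filterlim[OF this filterlim_real_sequentially]
      show ?thesis by (rule eventually_mono) (simp add: abs_of_nonneg)
    qed
    show "summable (\<lambda>n. real n powr - 2)" by (simp add: summable_real_powr_iff)
  qed
  ultimately have "AE \<omega> in M. \<forall>\<^sub>F n in sequentially. \<omega> \<notin> A n"
    by (intro AE_eventually_not_in[where b = "\<lambda>n. real n * (2 * exp (- h * sqrt (real n)))"])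
       (auto simp: A_def intro!: sets.finite_UN finK)
  thus ?thesis
  proof (rule AE_mp, intro AE_I2 impI)
    fix \<omega> assume \<omega>: "\<omega> \<in> space M" and ev: "\<forall>\<^sub>F n in sequentially. \<omega> \<notin> A n"
    from ev show "\<forall>\<^sub>F n in sequentially. \<forall>k\<in>{1..n}. sqrt (real n) \<le> real k \<longrightarrow>
      \<bar>real (hits (null_low (real k / (a * real n))) 0 n \<omega>) - \<beta> * real k\<bar> \<le> \<delta> * (\<beta> * real k)"
    proof eventually_elim
      case (elim n)
      show ?case
      proof (intro ballI impI)
        fix k assume "k \<in> {1..n}" "sqrt (real n) \<le> real k"
        hence "k \<in> K n" by (simp add: K_def)
        hence "\<omega> \<notin> Up n k" "\<omega> \<notin> Lo n k" using elim by (auto simp: A_def)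
        hence "H n k \<omega> < \<beta> * real k * (1 + \<delta>)" "\<beta> * real k - \<delta> * (\<beta> * real k) < H n k \<omega>"
          using \<omega> by (auto simp: Up_def Lo_def)
        thus "\<bar>real (hits (null_low (real k / (a * real n))) 0 n \<omega>) - \<beta> * real k\<bar> \<le> \<delta> * (\<beta> * real k)"
          by (simp add: H_def abs_le_iff algebra_simps)
      qed
    qed
  qed
qed

text \<open>The exponent \<open>1/2\<close> is below \<open>\<nu>\<close> because \<open>l \<ge> 2\<close> gives \<open>\<nu> \<ge> 2/3\<close>.\<close>

lemma AE_R_ge_sqrt: "AE \<omega> in M. \<forall>\<^sub>F n in sequentially. sqrt (real n) \<le> real (R n \<omega>)"
  using lower_bound_AE[of "nu - 1 / 2"] nu_bounds by (simp add: powr_half_sqrt)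

lemma V_ratio_AE: "AE \<omega> in M. (\<lambda>n. real (V n \<omega>) / real (R n \<omega>)) \<longlonglongrightarrow> (1 - \<pi>) / a"
proof -
  define \<beta> where "\<beta> = (1 - \<pi>) / a"
  have \<beta>: "\<beta> > 0" using pi_range a_gt_1 by (simp add: \<beta>_def)
  have "AE \<omega> in M. \<forall>j. \<forall>\<^sub>F n in sequentially. \<forall>k\<in>{1..n}. sqrt (real n) \<le> real k \<longrightarrow>
    \<bar>real (hits (null_low (real k / (a * real n))) 0 n \<omega>) - \<beta> * real k\<bar> \<le> 1 / real (Suc j) * (\<beta> * real k)"
    unfolding AE_all_countable \<beta>_def by (intro allI null_hits_AE) simp
  with AE_R_ge_sqrt show ?thesis
  proof eventually_elim
    case (elim \<omega>)
    show ?case unfolding \<beta>_def[symmetric]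
    proof (rule tendstoI)
      fix e :: real assume "e > 0"
      obtain j where "\<beta> / e < real j" using reals_Archimedean2 by blast
      hence j: "\<beta> / e < real (Suc j)" by simp
      have je: "1 / real (Suc j) * \<beta> < e" using j \<open>e > 0\<close> by (simp add: field_simps)
      from elim(1) spec[OF elim(2), of j] eventually_ge_at_top[of 1]
      show "\<forall>\<^sub>F n in sequentially. dist (real (V n \<omega>) / real (R n \<omega>)) \<beta> < e"
      proof eventually_elim
        case (elim n)
        define r where "r = R n \<omega>"
        have "1 \<le> sqrt (real n)" using elim(3) by simp
        hence r1: "1 \<le> r" using elim(1) unfolding r_def by linarith
        have rn: "r \<in> {1..n}" using r1 BH_R_le[of "1 / a" "\<lambda>j. p j \<omega>" n] by (auto simp: r_def)
        have V: "V n \<omega> = hits (null_low (real r / (a * real n))) 0 n \<omega>"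
          using BH_V_eq[of "1 / a" "\<lambda>j. p j \<omega>" n "\<lambda>j. \<theta> j \<omega>"] r1 a_gt_1
          unfolding hits_null_low r_def by simp
        have "\<bar>real (V n \<omega>) - \<beta> * real r\<bar> \<le> 1 / real (Suc j) * (\<beta> * real r)"
          unfolding V using bspec[OF elim(2) rn] elim(1) by (simp add: r_def)
        also have "\<dots> < e * real r"
          using mult_strict_right_mono[OF je, of "real r"] r1 by (simp only: mult.assoc)
        finally have "\<bar>real (V n \<omega>) - \<beta> * real r\<bar> < e * real r" .
        moreover have "real (V n \<omega>) / real r - \<beta> = (real (V n \<omega>) - \<beta> * real r) / real r"
          using r1 by (simp add: field_simps)
        ultimately have "\<bar>real (V n \<omega>) / real r - \<beta>\<bar> < e" using r1 by (simp add: field_simps)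
        thus ?case by (simp add: dist_real_def r_def)
      qed
    qed
  qed
qed

lemma true_discoveries_AE:
  "AE \<omega> in M. (\<lambda>n. real (R n \<omega>) - real (V n \<omega>)) \<sim>[at_top] (\<lambda>n. (1 - (1 - \<pi>) / a) * real (R n \<omega>))"
  using AE_R_ge_sqrt V_ratio_AE
proof eventually_elim
  case (elim \<omega>)
  define \<beta> where "\<beta> = (1 - \<pi>) / a"
  have "\<beta> < 1" using pi_range a_gt_1 by (simp add: \<beta>_def)
  have R0: "\<forall>\<^sub>F n in sequentially. real (R n \<omega>) \<noteq> 0"
    using elim(1) eventually_gt_at_top[of 0]
  proof eventually_elim
    case (elim n)
    have "0 < sqrt (real n)" using elim by simp
    thus ?case using elim by linarith
  qed
  have "(\<lambda>n. (1 - real (V n \<omega>) / real (R n \<omega>)) / (1 - \<beta>)) \<longlonglongrightarrow> (1 - \<beta>) / (1 - \<beta>)"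
    using elim(2) \<open>\<beta> < 1\<close> unfolding \<beta>_def[symmetric]
    by (intro tendsto_divide tendsto_diff tendsto_const) auto
  hence "(\<lambda>n. (1 - real (V n \<omega>) / real (R n \<omega>)) / (1 - \<beta>)) \<longlonglongrightarrow> 1" using \<open>\<beta> < 1\<close> by simp
  moreover have "\<forall>\<^sub>F n in sequentially. (1 - real (V n \<omega>) / real (R n \<omega>)) / (1 - \<beta>) =
      (real (R n \<omega>) - real (V n \<omega>)) / ((1 - \<beta>) * real (R n \<omega>))"
    using R0 by eventually_elim (use \<open>\<beta> < 1\<close> in \<open>simp add: field_simps\<close>)
  ultimately have "(\<lambda>n. (real (R n \<omega>) - real (V n \<omega>)) / ((1 - \<beta>) * real (R n \<omega>))) \<longlonglongrightarrow> 1"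
    using tendsto_cong by fast
  thus ?case unfolding \<beta>_def[symmetric] by (rule asymp_equivI'[rotated]) 
qed

lemma ln_R_AE: "AE \<omega> in M. (\<lambda>n. ln (real (R n \<omega>)) / ln (real n)) \<longlonglongrightarrow> nu"
proof -
  obtain \<kappa> where \<kappa>: "0 < \<kappa>" "1 + nu < c\<^sup>2 / (2 * a ^ (2 * l)) * \<kappa> ^ (2 * l - 1)"
  proof -
    define b where "b = c\<^sup>2 / (2 * a ^ (2 * l))"
    have b: "b > 0" using c_pos a_gt_1 by (simp add: b_def)
    define \<kappa> where "\<kappa> = max 1 ((2 + nu) / b)"
    have "\<kappa> ^ 1 \<le> \<kappa> ^ (2 * l - 1)" using l_ge_2 by (intro power_increasing) (auto simp: \<kappa>_def)
    hence "(2 + nu) / b \<le> \<kappa> ^ (2 * l - 1)" by (simp add: \<kappa>_def)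
    hence "2 + nu \<le> b * \<kappa> ^ (2 * l - 1)" using b by (simp add: field_simps)
    thus ?thesis using that[of \<kappa>] by (simp add: \<kappa>_def b_def)
  qed
  have "AE \<omega> in M. \<forall>j. \<forall>\<^sub>F n in sequentially. real n powr (nu - 1 / real (j + 2)) \<le> real (R n \<omega>)"
  proof (unfold AE_all_countable, intro allI lower_bound_AE)
    fix j
    have "1 / real (j + 2) \<le> 1 / 2" by (intro divide_left_mono) auto
    thus "1 / real (j + 2) < nu" using nu_bounds by linarith
  qed simp
  with upper_bound_AE[OF \<kappa>] show ?thesis
  proof eventually_elim
    case (elim \<omega>)
    show ?case
    proof (rule order_tendstoI)
      fix y assume "y < nu"
      obtain j where j: "1 / (nu - y) < real j" using reals_Archimedean2 by blast
      have "1 / real (j + 2) < nu - y"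
      proof -
        have "1 < real j * (nu - y)" using j \<open>y < nu\<close> by (simp add: field_simps)
        also have "\<dots> \<le> real (j + 2) * (nu - y)" using \<open>y < nu\<close> by (intro mult_right_mono) auto
        finally show ?thesis by (simp add: field_simps)
      qed
      hence yj: "y < nu - 1 / real (j + 2)" by linarith
      from spec[OF elim(2), of j] eventually_gt_at_top[of 1]
      show "\<forall>\<^sub>F n in sequentially. y < ln (real (R n \<omega>)) / ln (real n)"
      proof eventually_elim
        case (elim n)
        have n: "real n > 0" "ln (real n) > 0" using elim by auto
        have "0 < real n powr (nu - 1 / real (j + 2))" using n by simp
        hence "ln (real n powr (nu - 1 / real (j + 2))) \<le> ln (real (R n \<omega>))"
          using elim(1) by (intro ln_mono)
        hence "(nu - 1 / real (j + 2)) * ln (real n) \<le> ln (real (R n \<omega>))"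
          using n by (simp only: ln_powr)
        hence "nu - 1 / real (j + 2) \<le> ln (real (R n \<omega>)) / ln (real n)"
          using n(2) by (simp only: pos_le_divide_eq)
        thus ?case using yj by linarith
      qed
    next
      fix y assume "nu < y"
      have "(\<lambda>n. (ln \<kappa> + nu * ln (real n) + (1 - nu) * ln (ln (real n))) / ln (real n)) \<longlonglongrightarrow> nu"
        by real_asymp
      hence "\<forall>\<^sub>F n in sequentially. (ln \<kappa> + nu * ln (real n) + (1 - nu) * ln (ln (real n))) / ln (real n) < y"
        using \<open>nu < y\<close> by (rule order_tendstoD)
      from this elim(1) spec[OF elim(2), of 0] eventually_gt_at_top[of 1]
      show "\<forall>\<^sub>F n in sequentially. ln (real (R n \<omega>)) / ln (real n) < y"
      proof eventually_elim
        case (elim n)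
        have n: "real n > 0" "ln (real n) > 0" using elim by auto
        have "0 < real n powr (nu - 1 / real (0 + 2))" using n by simp
        hence R: "0 < real (R n \<omega>)" using elim(3) by linarith
        hence "ln (real (R n \<omega>)) \<le> ln (\<kappa> * (real n powr nu * ln (real n) powr (1 - nu)))"
          using elim(2) by (intro ln_mono) auto
        also have "\<dots> = ln \<kappa> + nu * ln (real n) + (1 - nu) * ln (ln (real n))"
          using n \<kappa>(1) by (simp add: ln_mult ln_powr)
        finally have "ln (real (R n \<omega>)) / ln (real n) \<le>
          (ln \<kappa> + nu * ln (real n) + (1 - nu) * ln (ln (real n))) / ln (real n)"
          using n by (intro divide_right_mono) auto
        thus ?case using elim(1) by linarith
      qed
    qed
  qed
qed

text \<open>The constant \<open>K\<close> is the value of \<open>\<kappa>\<close> for which the hypothesis of \<open>upper_bound_AE\<close> is an equality, so every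
  larger \<open>\<kappa>\<close> is an eventual upper bound.\<close>

lemma limsup_R_AE:
  "AE \<omega> in M. limsup (\<lambda>n. ereal (real (R n \<omega>) / (real n powr nu * ln (real n) powr (1 - nu))))
     \<le> ereal ((sqrt (2 * (1 + nu)) * a ^ l / c) powr (2 * (1 - nu)))"
proof -
  define z where "z = sqrt (2 * (1 + nu)) * a ^ l / c"
  have z: "z > 0" unfolding z_def using nu_bounds a_gt_1 c_pos by simp
  define K where "K = z powr (2 * (1 - nu))"
  have K: "K > 0" unfolding K_def using z by simp
  have Kp: "K ^ (2 * l - 1) = z\<^sup>2"
  proof -
    have "K ^ (2 * l - 1) = z powr (2 * (1 - nu) * real (2 * l - 1))"
      unfolding K_def using z by (simp add: powr_powr flip: powr_realpow)
    also have "2 * (1 - nu) * real (2 * l - 1) = real 2"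
    proof -
      have "2 * real l - 1 \<noteq> 0" using l_ge_2 by linarith
      moreover have "2 * (1 / m) * m = real 2" if "m \<noteq> 0" for m :: real using that by simp
      ultimately show ?thesis unfolding real_2l one_minus_nu by blast
    qed
    finally show ?thesis using z by (simp only: powr_realpow)
  qed
  have "AE \<omega> in M. \<forall>j. \<forall>\<^sub>F n in sequentially.
     real (R n \<omega>) < (K + 1 / real (Suc j)) * (real n powr nu * ln (real n) powr (1 - nu))"
  proof (unfold AE_all_countable, intro allI upper_bound_AE)
    fix j
    show "0 < K + 1 / real (Suc j)" using K by (intro add_pos_pos) auto
    have "z\<^sup>2 = 2 * (1 + nu) * a ^ (2 * l) / c\<^sup>2"
      unfolding z_def using nu_bounds by (simp add: power_divide power_mult_distrib power_mult mult.commute)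
    hence "1 + nu = c\<^sup>2 / (2 * a ^ (2 * l)) * z\<^sup>2" using a_gt_1 c_pos by simp
    also have "\<dots> < c\<^sup>2 / (2 * a ^ (2 * l)) * (K + 1 / real (Suc j)) ^ (2 * l - 1)"
    proof (rule mult_strict_left_mono)
      have "K ^ (2 * l - 1) < (K + 1 / real (Suc j)) ^ (2 * l - 1)"
        using K l_ge_2 by (intro power_strict_mono) auto
      thus "z\<^sup>2 < (K + 1 / real (Suc j)) ^ (2 * l - 1)" unfolding Kp .
    qed (use c_pos a_gt_1 in auto)
    finally show "1 + nu < c\<^sup>2 / (2 * a ^ (2 * l)) * (K + 1 / real (Suc j)) ^ (2 * l - 1)" .
  qed
  thus ?thesis unfolding z_def[symmetric] K_def[symmetric]
  proof eventually_elim
    case (elim \<omega>)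
    let ?L = "limsup (\<lambda>n. ereal (real (R n \<omega>) / (real n powr nu * ln (real n) powr (1 - nu))))"
    have "?L \<le> ereal (K + 1 / real (Suc j))" for j
    proof (rule Limsup_bounded)
      from spec[OF elim, of j] eventually_gt_at_top[of 1]
      show "\<forall>\<^sub>F n in sequentially. ereal (real (R n \<omega>) / (real n powr nu * ln (real n) powr (1 - nu))) \<le> ereal (K + 1 / real (Suc j))"
      proof eventually_elim
        case (elim n)
        have "0 < real n powr nu * ln (real n) powr (1 - nu)" using elim(2) by simp
        thus ?case using elim(1) by (simp add: pos_divide_le_eq less_imp_le del: of_nat_Suc)
      qed
    qed
    moreover have "(\<lambda>j. K + 1 / real (Suc j)) \<longlonglongrightarrow> K" by real_asymp
    hence "(\<lambda>j. ereal (K + 1 / real (Suc j))) \<longlonglongrightarrow> ereal K" by (rule tendsto_ereal)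
    ultimately show "?L \<le> ereal K"
      using LIMSEQ_le_const[of "\<lambda>j. ereal (K + 1 / real (Suc j))" "ereal K" ?L] by auto
  qed
qed

end

section \<open>From derivatives at 0 to the critical case\<close>

context random_effects_model
begin

text \<open>The infimum is not attained: \<open>u / F u\<close> exceeds \<open>1 / a\<close> and tends to it at 0.\<close>

lemma alpha_star_eq:
  assumes D: "(F has_real_derivative a) (at 0 within {0..1})" and "0 < a"
    and below: "\<And>u. u \<in> {0<..1} \<Longrightarrow> F u < a * u"
  shows "alpha_star F = 1 / a"
proof (rule antisym)
  have lower: "1 / a \<le> u / F u" if "u \<in> {0<..1}" for u
  proof -
    have "F u / a \<le> u"
      using below[OF that] \<open>0 < a\<close> by (simp add: pos_divide_le_eq mult.commute)
    thus ?thesis using F_pos[OF that] by (simp add: pos_le_divide_eq)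
  qed
  hence bdd: "bdd_below ((\<lambda>u. u / F u) ` {0<..1})" 
    by (intro bdd_belowI2)
  show "1 / a \<le> alpha_star F" unfolding alpha_star_def
    by (rule cINF_greatest) (use lower in auto)
  have "((\<lambda>y. (F y - F 0) / (y - 0)) \<longlongrightarrow> a) (at 0 within {0..1})"
    using D unfolding has_field_derivative_iff .
  hence "((\<lambda>y. F y / y) \<longlongrightarrow> a) (at_right 0)"
    unfolding cdf_0 diff_0_right at_within_Icc_at_right[OF zero_less_one] .
  hence "((\<lambda>y. 1 / (F y / y)) \<longlongrightarrow> 1 / a) (at_right 0)"
    by (rule tendsto_divide[OF tendsto_const]) (use \<open>0 < a\<close> in simp)
  moreover have "\<forall>\<^sub>F y in at_right 0. alpha_star F \<le> 1 / (F y / y)"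
  proof -
    have "\<forall>\<^sub>F y in at_right 0. y \<in> {0<..<1::real}" by (rule eventually_at_right_real) simp
    thus ?thesis
    proof eventually_elim
      case (elim y)
      hence "alpha_star F \<le> y / F y" unfolding alpha_star_def by (intro cINF_lower[OF bdd]) auto
      thus ?case by simp
    qed
  qed
  ultimately show "alpha_star F \<le> 1 / a"
    by (rule tendsto_lowerbound) simp
qed

text \<open>The first nonzero derivative of order at least 2 has to be negative, since \<open>F\<close> lies below its tangent.\<close>

lemma gap_expansion:
  assumes T: "times_differentiable_within {0..1} F l 0" and l: "2 \<le> l"
  defines "D \<equiv> \<lambda>i. higher_deriv_within {0..1} F i 0"
  assumes zero: "\<And>i. 1 < i \<Longrightarrow> i < l \<Longrightarrow> D i = 0" and nz: "D l \<noteq> 0"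
    and below: "\<And>u. u \<in> {0<..1} \<Longrightarrow> F u < D 1 * u"
  shows "\<And>e. 0 < e \<Longrightarrow> \<exists>d>0. \<forall>u\<in>{0..1}. u < d \<longrightarrow>
    \<bar>D 1 * u - F u - \<bar>D l\<bar> / fact l * u ^ l\<bar> \<le> e * u ^ l"
proof -
  obtain m where m: "l = Suc m" using l by (cases l) auto
  have "(\<Sum>i\<le>l. D i / fact i * u ^ i) = (\<Sum>i\<in>{1, l}. D i / fact i * u ^ i)" for u
  proof (rule sum.mono_neutral_right)
    show "\<forall>i\<in>{..l} - {1, l}. D i / fact i * u ^ i = 0"
    proof
      fix i assume i: "i \<in> {..l} - {1, l}"
      show "D i / fact i * u ^ i = 0"
      proof (cases "i = 0")
        case True
        thus ?thesis by (simp add: D_def cdf_0)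
      next
        case False
        thus ?thesis using zero[of i] i by simp
      qed
    qed
  qed (use l in auto)
  hence poly: "(\<Sum>i\<le>l. higher_deriv_within {0..1} F i 0 / fact i * u ^ i) = D 1 * u + D l / fact l * u ^ l" for u
    using l by (simp add: D_def)
  have E: "\<exists>d>0. \<forall>u\<in>{0..1}. u < d \<longrightarrow> \<bar>F u - (D 1 * u + D l / fact l * u ^ l)\<bar> \<le> e * u ^ l"
    if "0 < e" for e
    using taylor_peano[of F m e, OF _ that] T unfolding m[symmetric] poly by blast
  have "D l < 0"
  proof (rule ccontr)
    assume "\<not> D l < 0"
    hence Dl: "D l / fact l > 0" using nz by simp
    then obtain d where d: "d > 0" "\<And>u. u \<in> {0..1} \<Longrightarrow> u < d \<Longrightarrow>
      \<bar>F u - (D 1 * u + D l / fact l * u ^ l)\<bar> \<le> D l / fact l * u ^ l"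
      using E by blast
    define u where "u = min 1 (d / 2)"
    have u: "u \<in> {0<..1}" "u < d" using d(1) by (auto simp: u_def)
    have "D 1 * u \<le> F u" using abs_le_D2[OF d(2)[of u]] u by simp
    thus False using below[OF u(1)] by simp
  qed
  hence "D 1 * u - F u - \<bar>D l\<bar> / fact l * u ^ l = - (F u - (D 1 * u + D l / fact l * u ^ l))" for u
    by simp
  hence "\<bar>D 1 * u - F u - \<bar>D l\<bar> / fact l * u ^ l\<bar> = \<bar>F u - (D 1 * u + D l / fact l * u ^ l)\<bar>" for u
    by (simp only: abs_minus_cancel)
  thus "\<exists>d>0. \<forall>u\<in>{0..1}. u < d \<longrightarrow>
    \<bar>D 1 * u - F u - \<bar>D l\<bar> / fact l * u ^ l\<bar> \<le> e * u ^ l" if "0 < e" for e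
    using E[OF that] by simp
qed

end

theorem theorem2p3:
  fixes M :: "'a measure"
    and p :: "nat \<Rightarrow> 'a \<Rightarrow> real"
    and \<theta> :: "nat \<Rightarrow> 'a \<Rightarrow> bool"
    and \<pi> \<alpha> \<beta>\<^sub>s \<nu>\<^sub>0 :: real
    and G F :: "real \<Rightarrow> real"
    and DF :: "nat \<Rightarrow> real"
    and I :: "nat set"
    and l :: nat
    and R V :: "nat \<Rightarrow> 'a \<Rightarrow> nat"
  defines "F \<equiv> pval_cdf \<pi> G"
    and "DF \<equiv> \<lambda>i. higher_deriv_within {0..1} F i 0"
    and "I \<equiv> {i. 1 < i \<and> times_differentiable_within {0..1} F i 0 \<and> DF i \<noteq> 0}"
    and "l \<equiv> (LEAST i. i \<in> I)"
    and "\<nu>\<^sub>0 \<equiv> (2 * real l - 2) / (2 * real l - 1)"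
    and "\<beta>\<^sub>s \<equiv> (1 - \<pi>) * alpha_star F"
    and "R \<equiv> \<lambda>n \<omega>. BH_R \<alpha> (\<lambda>j. p j \<omega>) n"
    and "V \<equiv> \<lambda>n \<omega>. BH_V \<alpha> (\<lambda>j. p j \<omega>) (\<lambda>j. \<theta> j \<omega>) n"
  assumes model: "random_effects_model M p \<theta> \<pi> G"
    and twice_diff: "times_differentiable_within {0..1} F 2 0"
    and below_tangent: "\<And>u. u \<in> {0<..1} \<Longrightarrow> DF 1 * u > F u"
  shows "alpha_star F = 1 / DF 1 \<and>
    (I \<noteq> {} \<longrightarrow> \<alpha> = alpha_star F \<longrightarrow>
      (AE \<omega> in M. (\<lambda>n. ln (real (R n \<omega>)) / ln (real n)) \<longlonglongrightarrow> \<nu>\<^sub>0) \<and>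
      (AE \<omega> in M.
         limsup (\<lambda>n. ereal (real (R n \<omega>) / (real n powr \<nu>\<^sub>0 * ln (real n) powr (1 - \<nu>\<^sub>0))))
           \<le> ereal ((fact l * sqrt (2 * (1 + \<nu>\<^sub>0)) * DF 1 ^ l / \<bar>DF l\<bar>) powr (2 * (1 - \<nu>\<^sub>0)))) \<and>
      (AE \<omega> in M. (\<lambda>n. real (V n \<omega>) / real (R n \<omega>)) \<longlonglongrightarrow> \<beta>\<^sub>s) \<and>
      (AE \<omega> in M. (\<lambda>n. real (R n \<omega>) - real (V n \<omega>)) \<sim>[at_top] (\<lambda>n. (1 - \<beta>\<^sub>s) * real (R n \<omega>))))"
proof -
  interpret model: random_effects_model M p \<theta> \<pi> G by (rule model)
  define a where "a = DF 1"
  have below: "F u < a * u" if "u \<in> {0<..1}" for u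
    using below_tangent[OF that] by (simp add: a_def)
  have a0: "0 < a" using below[of 1] model.F_1 unfolding F_def by simp
  have "times_differentiable_within {0..1} F (Suc 0) 0"
    using twice_diff by (rule times_differentiable_within_le) auto
  hence "higher_deriv_within {0..1} F 0 differentiable (at 0 within {0..1})" by simp
  moreover have hd0: "higher_deriv_within {0..1} F 0 = F" by (simp add: fun_eq_iff)
  ultimately have "(F has_real_derivative vector_derivative F (at 0 within {0..1})) (at 0 within {0..1})"
    by (intro vector_derivative_within_unit) auto
  also have "vector_derivative F (at 0 within {0..1}) = a" unfolding a_def DF_def by (simp add: hd0)
  finally have \<alpha>: "alpha_star F = 1 / a"
    using a0 below unfolding F_def by (rule model.alpha_star_eq)
  show ?thesis
  proof (intro conjI impI)
    show "alpha_star F = 1 / DF 1" using \<alpha> by (simp add: a_def)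
  next
    assume I: "I \<noteq> {}" and \<alpha>': "\<alpha> = alpha_star F"
    have "l \<in> I" unfolding l_def by (rule LeastI_ex) (use I in blast)
    hence l: "2 \<le> l" "times_differentiable_within {0..1} F l 0" "DF l \<noteq> 0" by (auto simp: I_def)
    have zero: "DF i = 0" if "1 < i" "i < l" for i
    proof (rule ccontr)
      assume "DF i \<noteq> 0"
      moreover have "times_differentiable_within {0..1} F i 0"
        using l(2) by (rule times_differentiable_within_le) (use that in auto)
      ultimately have "i \<in> I" using that by (simp add: I_def)
      thus False using Least_le[of "\<lambda>i. i \<in> I" i] that(2) unfolding l_def by simp
    qed
    define c where "c = \<bar>DF l\<bar> / fact l"
    \<comment> \<open>Taylor expansion: all terms between the linear one and the one of order \<open>l\<close> vanish.\<close>
    interpret crit: critical_BH M p \<theta> \<pi> G a c l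
    proof
      show "2 \<le> l" by fact
      show "0 < c" using l(3) by (simp add: c_def)
      show "pval_cdf \<pi> G u < a * u" if "u \<in> {0<..1}" for u using below[OF that] unfolding F_def .
      show "\<exists>d>0. \<forall>u\<in>{0..1}. u < d \<longrightarrow> \<bar>a * u - pval_cdf \<pi> G u - c * u ^ l\<bar> \<le> e * u ^ l"
        if "0 < e" for e
        using l(2,1) zero l(3) below that unfolding a_def c_def DF_def F_def by (rule model.gap_expansion)
    qed
    have \<nu>: "\<nu>\<^sub>0 = crit.nu" by (simp add: \<nu>\<^sub>0_def crit.nu_def)
    have \<beta>: "\<beta>\<^sub>s = (1 - \<pi>) / a" by (simp add: \<beta>\<^sub>s_def \<alpha>)
    have K: "fact l * sqrt (2 * (1 + crit.nu)) * DF 1 ^ l / \<bar>DF l\<bar> = sqrt (2 * (1 + crit.nu)) * a ^ l / c"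
      by (simp add: c_def a_def)
    have RV: "R = (\<lambda>n \<omega>. BH_R (1 / a) (\<lambda>j. p j \<omega>) n)"
      "V = (\<lambda>n \<omega>. BH_V (1 / a) (\<lambda>j. p j \<omega>) (\<lambda>j. \<theta> j \<omega>) n)"
      unfolding R_def V_def \<alpha>' \<alpha> by simp_all
    show "AE \<omega> in M. (\<lambda>n. ln (real (R n \<omega>)) / ln (real n)) \<longlonglongrightarrow> \<nu>\<^sub>0"
      unfolding RV \<nu> by (rule crit.ln_R_AE)
    show "AE \<omega> in M.
         limsup (\<lambda>n. ereal (real (R n \<omega>) / (real n powr \<nu>\<^sub>0 * ln (real n) powr (1 - \<nu>\<^sub>0))))
           \<le> ereal ((fact l * sqrt (2 * (1 + \<nu>\<^sub>0)) * DF 1 ^ l / \<bar>DF l\<bar>) powr (2 * (1 - \<nu>\<^sub>0)))"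
      unfolding RV \<nu> K by (rule crit.limsup_R_AE)
    show "AE \<omega> in M. (\<lambda>n. real (V n \<omega>) / real (R n \<omega>)) \<longlonglongrightarrow> \<beta>\<^sub>s"
      unfolding RV \<beta> by (rule crit.V_ratio_AE)
    show "AE \<omega> in M. (\<lambda>n. real (R n \<omega>) - real (V n \<omega>)) \<sim>[at_top] (\<lambda>n. (1 - \<beta>\<^sub>s) * real (R n \<omega>))"
      unfolding RV \<beta> by (rule crit.true_discoveries_AE)
  qed
qed

end
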